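(* Let $A$ be an $m\times n$ matrix with non-zero columns $a_1,\ldots,a_n\in\mathbb{N}^m$, let $P_A\subset k[x_1,\ldots,x_n]$ be its toric ideal, and let $T$ be a subset of $\{t_1,\ldots,t_m\}$. If $P_A$ is a complete intersection, then $P_A\cap k[T_{\varphi^{-1}}]$ is a complete intersection.
   Context: $k$ is an arbitrary field. $\varphi:k[x_1,\ldots,x_n]\to k[t_1,\ldots,t_m]$ is the $k$-algebra homomorphism with $\varphi(x_i)=t^{a_i}$ (where $t^{a}=t_1^{a_{1}}\cdots t_m^{a_{m}}$), and $P_A=\ker\varphi$ is the toric ideal of $A$. For $T\subset\{t_1,\ldots,t_m\}$, $T_{\varphi^{-1}}:=\{x_i\mid\varphi(x_i)\in k[T]\}$; then $P_A\cap k[T_{\varphi^{-1}}]$ is the toric ideal (in the ring $k[T_{\varphi^{-1}}]$) of the matrix consisting of the columns $a_i$ of $A$ with $x_i\in T_{\varphi^{-1}}$. A toric ideal $P$ is a complete intersection if $\mu(P)=\mathrm{ht}(P)$, where $\mu(P)$ is its minimal number of generators (the zero ideal is a complete intersection). *)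

theory Defs
  imports
    "HOL-Algebra.Algebraic_Closure_Type"
    "HOL-Library.Poly_Mapping"
    "HOL-Library.Extended_Nat"
    "Jordan_Normal_Form.Matrix"
begin

section \<open>Polynomial rings\<close>

text \<open>
  Polynomials with coefficients in \<open>'k\<close> in variables indexed by natural numbers. For a set \<open>V\<close> of
  indices, \<open>mpoly_ring V\<close> is the ring of those polynomials in which only variables with index in
  \<open>V\<close> occur. Variables are numbered from \<open>0\<close>, so \<open>k[x\<^sub>1,\<dots>,x\<^sub>n]\<close> is \<open>mpoly_ring {..<n}\<close> and
  \<open>k[t\<^sub>1,\<dots>,t\<^sub>m]\<close> is \<open>mpoly_ring {..<m}\<close>; the \<open>x\<close>'s and the \<open>t\<close>'s share the same index type.
\<close>

type_synonym 'k mpoly = "(nat \<Rightarrow>\<^sub>0 nat) \<Rightarrow>\<^sub>0 'k"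

definition mpoly_ring :: "nat set \<Rightarrow> 'k::field mpoly ring" where
  "mpoly_ring V = ring_of_type_algebra
     \<lparr>carrier := {p. \<forall>e \<in> Poly_Mapping.keys p. Poly_Mapping.keys e \<subseteq> V}\<rparr>"

definition mconst :: "'k::field \<Rightarrow> 'k mpoly" where
  "mconst c = Poly_Mapping.single 0 c"

definition mvar :: "nat \<Rightarrow> 'k::field mpoly" where
  "mvar i = Poly_Mapping.single (Poly_Mapping.single i 1) 1"

definition mpoly_subst :: "(nat \<Rightarrow> 'k::field mpoly) \<Rightarrow> 'k mpoly \<Rightarrow> 'k mpoly" where
  "mpoly_subst f p =
     (\<Sum>e \<in> Poly_Mapping.keys p.
        mconst (Poly_Mapping.lookup p e) *
        (\<Prod>j \<in> Poly_Mapping.keys e. f j ^ Poly_Mapping.lookup e j))"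

section \<open>Minimal number of generators and height\<close>

text \<open>The value is \<open>\<infinity>\<close> if the ideal is not finitely generated.\<close>

definition min_gens :: "('a, 'b) ring_scheme \<Rightarrow> 'a set \<Rightarrow> enat" where
  "min_gens R I = (INF S \<in> {S. finite S \<and> S \<subseteq> carrier R \<and> genideal R S = I}. enat (card S))"

text \<open>A chain \<open>Q 0 \<subset> Q 1 \<subset> \<dots> \<subset> Q l = P\<close> of prime ideals has length \<open>l\<close>.\<close>

definition prime_height :: "('a, 'b) ring_scheme \<Rightarrow> 'a set \<Rightarrow> enat" where
  "prime_height R P =
     (SUP l \<in> {l. \<exists>Q. (\<forall>i\<le>l. primeideal (Q i) R) \<and> (\<forall>i<l. Q i \<subset> Q (Suc i)) \<and> Q l = P}. enat l)"

definition height :: "('a, 'b) ring_scheme \<Rightarrow> 'a set \<Rightarrow> enat" where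
  "height R I = (INF P \<in> {P. primeideal P R \<and> I \<subseteq> P}. prime_height R P)"

definition complete_intersection :: "('a, 'b) ring_scheme \<Rightarrow> 'a set \<Rightarrow> bool" where
  "complete_intersection R I \<longleftrightarrow> min_gens R I = height R I"

section \<open>Toric ideals\<close>

definition monomial_of :: "nat vec \<Rightarrow> 'k::field mpoly" where
  "monomial_of a = (\<Prod>i<dim_vec a. mvar i ^ (a $ i))"

text \<open>
  The \<open>k\<close>-algebra homomorphism sending \<open>x\<^sub>j\<close> to \<open>t\<close> to the power of the \<open>j\<close>-th column of \<open>A\<close>. Its
  values are meaningful only on \<open>mpoly_ring {..<dim_col A}\<close>.
\<close>

definition toric_hom :: "nat mat \<Rightarrow> 'k::field mpoly \<Rightarrow> 'k mpoly" where
  "toric_hom A = mpoly_subst (\<lambda>j. monomial_of (col A j))"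

definition toric_ideal :: "nat mat \<Rightarrow> 'k::field mpoly set" where
  "toric_ideal A = a_kernel (mpoly_ring {..<dim_col A}) (mpoly_ring {..<dim_row A}) (toric_hom A)"

text \<open>
  The indices \<open>j < n\<close> with \<open>\<phi>(x\<^sub>j) \<in> k[T]\<close>. The map \<open>\<phi>\<close> is an argument because it determines the
  coefficient field.
\<close>

definition inv_vars :: "('k::field mpoly \<Rightarrow> 'k mpoly) \<Rightarrow> nat \<Rightarrow> nat set \<Rightarrow> nat set" where
  "inv_vars \<phi> n T = {j. j < n \<and> \<phi> (mvar j) \<in> carrier (mpoly_ring T)}"

end

theory Submission
  imports Defs
begin

text \<open>
  Everything is compared with one number. A family of exponent vectors \<open>a j\<close>, \<open>j \<in> V\<close>, has a toric
  ideal \<open>toric a V\<close> and a space \<open>relspace a V\<close> of rational linear relations; let \<open>r\<close> be the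
  dimension of the latter.

  The height of \<open>toric a V\<close> is \<open>r\<close> (\<open>height_toric\<close>). A chain of prime ideals of length \<open>r\<close> comes from
  successively forbidding the relations to move a pivot coordinate. No chain is longer, because the
  \<open>card V - r\<close> variables away from the pivots are algebraically independent modulo the toric ideal,
  every step down a chain of primes enlarges an algebraically independent family by one element,
  and \<open>card V\<close> variables leave no room for more than \<open>card V\<close> algebraically independent polynomials.

  If all \<open>a j\<close> are nonzero, the minimal number of generators is at least \<open>r\<close> (\<open>min_gens_toric_ge\<close>). The
  ideal is then homogeneous for a grading in which every variable has positive weight. By Nakayama's
  argument any finite generating set can then be replaced by one that consists of binomials and
  has no more elements (\<open>binomial_generators\<close>); and the exponent differences of binomials that
  generate the ideal span the relation space (\<open>binomial_generators_span_relspace\<close>).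

  So a complete intersection is generated by \<open>r\<close> binomials, and their exponent differences form a
  basis of the relation space. The variables that \<open>\<phi>\<close> maps into \<open>k[T]\<close> form a face: if one monomial of a
  binomial in the ideal uses only these variables, so does the other. Setting the remaining variables
  to zero therefore either fixes a generator or kills it, and the fixed ones generate the ideal of
  the face (\<open>generators_restrict\<close>). Their exponent differences are still linearly independent, so their
  number is at most the dimension of the relation space of the face, which is the height of its
  ideal. The lower bound above, applied to the face, gives equality.
\<close>

abbreviation keys :: "('a \<Rightarrow>\<^sub>0 'b::zero) \<Rightarrow> 'a set" where "keys \<equiv> Poly_Mapping.keys"
abbreviation lookup :: "('a \<Rightarrow>\<^sub>0 'b::zero) \<Rightarrow> 'a \<Rightarrow> 'b" where "lookup \<equiv> Poly_Mapping.lookup"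
abbreviation single :: "'a \<Rightarrow> 'b \<Rightarrow> ('a \<Rightarrow>\<^sub>0 'b::zero)" where "single \<equiv> Poly_Mapping.single"

section \<open>Linear extension\<close>

definition pscale :: "'k::comm_semiring_1 \<Rightarrow> ('a \<Rightarrow>\<^sub>0 'k) \<Rightarrow> ('a \<Rightarrow>\<^sub>0 'k)" where
  "pscale c p = Poly_Mapping.map ((*) c) p"

text \<open>
  A finitely supported function is a formal linear combination of its arguments, and \<open>lext h\<close> is the
  linear map with prescribed values \<open>h\<close> on the basis. It is stated over semirings because it serves
  three purposes: with coefficients in \<open>k\<close> it gives maps between polynomial rings, over \<open>\<nat>\<close> the
  map from the exponents in \<open>x\<close> to those in \<open>t\<close>, and over \<open>\<rat>\<close> the linear map whose kernel is the
  relation space.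
\<close>

definition lext :: "('a \<Rightarrow> ('b \<Rightarrow>\<^sub>0 'k)) \<Rightarrow> ('a \<Rightarrow>\<^sub>0 'k) \<Rightarrow> ('b \<Rightarrow>\<^sub>0 'k::comm_semiring_1)" where
  "lext h p = (\<Sum>e\<in>keys p. pscale (lookup p e) (h e))"

lemma lookup_pscale [simp]: "lookup (pscale c p) i = c * lookup p i"
  by (simp add: pscale_def map.rep_eq when_def)

lemma pscale_0 [simp]: "pscale 0 p = 0" "pscale c 0 = 0"
  by (auto intro!: poly_mapping_eqI)

lemma pscale_1 [simp]: "pscale 1 p = p"
  by (auto intro!: poly_mapping_eqI)

lemma pscale_pscale [simp]: "pscale c (pscale d p) = pscale (c * d) p"
  by (auto intro!: poly_mapping_eqI simp: mult.assoc)

lemma pscale_add: "pscale c (p + q) = pscale c p + pscale c q" "pscale (c + d) p = pscale c p + pscale d p"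
  by (auto intro!: poly_mapping_eqI simp: lookup_add algebra_simps)

lemma pscale_sum: "pscale c (sum f A) = (\<Sum>x\<in>A. pscale c (f x))"
  by (induction A rule: infinite_finite_induct) (auto simp: pscale_add)

lemma pscale_single [simp]: "pscale c (single e d) = single e (c * d)"
  by (auto intro!: poly_mapping_eqI simp: lookup_single when_def)

lemma pscale_eq_mult: "pscale c p = single 0 c * (p :: 'a::monoid_add \<Rightarrow>\<^sub>0 'k::comm_semiring_1)"
  by (simp add: pscale_def mult_map_scale_conv_mult)

lemma pscale_eq_mconst: "pscale c p = mconst c * p"
  by (simp add: pscale_eq_mult mconst_def)

lemma mult_pscale:
  fixes p q :: "'a::comm_monoid_add \<Rightarrow>\<^sub>0 'k::comm_semiring_1"
  shows "pscale c p * q = pscale c (p * q)" "p * pscale c q = pscale c (p * q)"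
  by (simp_all add: pscale_eq_mult algebra_simps)

lemma keys_pscale: "keys (pscale c p) \<subseteq> keys p"
  by (auto simp: in_keys_iff)

interpretation vs: vector_space "pscale :: 'k::field \<Rightarrow> ('a \<Rightarrow>\<^sub>0 'k) \<Rightarrow> ('a \<Rightarrow>\<^sub>0 'k)"
  by unfold_locales (auto simp: pscale_add)

interpretation vsp: vector_space_pair
  "pscale :: 'k::field \<Rightarrow> ('a \<Rightarrow>\<^sub>0 'k) \<Rightarrow> ('a \<Rightarrow>\<^sub>0 'k)" "pscale :: 'k::field \<Rightarrow> ('b \<Rightarrow>\<^sub>0 'k) \<Rightarrow> ('b \<Rightarrow>\<^sub>0 'k)"
  by unfold_locales

lemma lext_superset:
  assumes "finite S" "keys p \<subseteq> S"
  shows "lext h p = (\<Sum>e\<in>S. pscale (lookup p e) (h e))"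
  unfolding lext_def by (rule sum.mono_neutral_left) (use assms in \<open>auto simp: in_keys_iff\<close>)

lemma lookup_lext: "lookup (lext h p) i = (\<Sum>e\<in>keys p. lookup p e * lookup (h e) i)"
  by (simp add: lext_def lookup_sum)

lemma lext_0 [simp]: "lext h 0 = 0"
  by (simp add: lext_def)

lemma lext_add: "lext h (p + q) = lext h p + lext h q"
proof -
  have "keys (p + q) \<subseteq> keys p \<union> keys q"
    by (rule keys_add)
  thus ?thesis
    by (simp add: lext_superset[of "keys p \<union> keys q"] lookup_add pscale_add sum.distrib)
qed

lemma lext_pscale: "lext h (pscale c p) = pscale c (lext h p)"
  by (simp add: lext_superset[OF _ keys_pscale] lext_def[of _ p] pscale_sum)

lemma lext_sum: "lext h (sum f A) = (\<Sum>x\<in>A. lext h (f x))"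
  by (induction A rule: infinite_finite_induct) (auto simp: lext_add)

lemma lext_uminus: "lext h (- p) = - lext h (p :: 'a \<Rightarrow>\<^sub>0 'k::comm_ring_1)"
  using lext_add[of h p "- p"] by (simp add: eq_neg_iff_add_eq_0 add.commute)

lemma lext_diff: "lext h (p - q) = lext h p - lext h (q :: 'a \<Rightarrow>\<^sub>0 'k::comm_ring_1)"
  using lext_add[of h p "- q"] by (simp add: lext_uminus)

lemma lext_single [simp]: "lext h (single e c) = pscale c (h e)"
  by (subst lext_superset[of "{e}"]) auto

lemma lext_cong:
  assumes "\<And>e. e \<in> keys p \<Longrightarrow> h e = h' e"
  shows "lext h p = lext h' p"
  using assms by (simp add: lext_def)

lemma lext_lext: "lext h (lext h' p) = lext (\<lambda>e. lext h (h' e)) p"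
  by (simp add: lext_def[of h'] lext_def[of "\<lambda>e. lext h (h' e)"] lext_sum lext_pscale)

lemma lext_ident [simp]: "lext (\<lambda>e. single e 1) p = p"
proof (rule poly_mapping_eqI)
  fix i
  have "lookup (lext (\<lambda>e. single e 1) p) i = (\<Sum>e\<in>keys p. if i = e then lookup p e else 0)"
    unfolding lookup_lext by (rule sum.cong) (auto simp: lookup_single when_def)
  also have "\<dots> = lookup p i" by (simp add: in_keys_iff)
  finally show "lookup (lext (\<lambda>e. single e 1) p) i = lookup p i" .
qed

lemma sum_singles: "(\<Sum>e\<in>keys p. single e (lookup p e)) = (p :: 'a \<Rightarrow>\<^sub>0 'k::comm_semiring_1)"
  using lext_ident[of p] unfolding lext_def by simp

lemma keys_sum_subset: "keys (sum f A) \<subseteq> (\<Union>x\<in>A. keys (f x))"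
proof (induction A rule: infinite_finite_induct)
  case (insert x F)
  thus ?case using keys_add[of "f x" "sum f F"] by auto
qed auto

lemma keys_lext: "keys (lext h p) \<subseteq> (\<Union>e\<in>keys p. keys (h e))"
  unfolding lext_def
  by (rule order.trans[OF keys_sum_subset]) (rule UN_mono[OF order.refl keys_pscale])

lemma lext_mem_subspace:
  assumes "vs.subspace S" "\<And>e. e \<in> keys p \<Longrightarrow> h e \<in> S"
  shows "lext h p \<in> S"
  unfolding lext_def using assms by (intro vs.subspace_sum vs.subspace_scale) auto

lemma lext_mult:
  fixes h :: "'a::comm_monoid_add \<Rightarrow> ('b::comm_monoid_add \<Rightarrow>\<^sub>0 'k::comm_semiring_1)"
  assumes h: "\<And>e e'. h (e + e') = h e * h e'"
  shows "lext h (p * q) = lext h p * lext h q"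
proof -
  have "p * q = (\<Sum>e\<in>keys p. single e (lookup p e)) * (\<Sum>e'\<in>keys q. single e' (lookup q e'))"
    by (simp add: sum_singles)
  also have "lext h \<dots> = lext h p * lext h q"
    unfolding sum_product lext_sum mult_single lext_single h lext_def[of h p] lext_def[of h q]
    by (intro sum.cong refl) (simp add: mult_pscale mult.commute[of "lookup q _"])
  finally show ?thesis .
qed

section \<open>Polynomial rings\<close>

abbreviation polys :: "nat set \<Rightarrow> 'k::field mpoly set" where
  "polys V \<equiv> carrier (mpoly_ring V)"

abbreviation xpow :: "(nat \<Rightarrow>\<^sub>0 nat) \<Rightarrow> 'k::field mpoly" where
  "xpow e \<equiv> single e 1"

lemma in_polys: "p \<in> polys V \<longleftrightarrow> (\<forall>e\<in>keys p. keys e \<subseteq> V)"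
  by (simp add: mpoly_ring_def)

lemma mpoly_ring_ops [simp]:
  "x \<otimes>\<^bsub>mpoly_ring V\<^esub> y = x * y" "x \<oplus>\<^bsub>mpoly_ring V\<^esub> y = x + y"
  "\<one>\<^bsub>mpoly_ring V\<^esub> = 1" "\<zero>\<^bsub>mpoly_ring V\<^esub> = 0"
  by (simp_all add: mpoly_ring_def ring_of_type_algebra_def)

lemma polys_0 [simp]: "0 \<in> polys V"
  and polys_1 [simp]: "1 \<in> polys V"
  by (simp_all add: in_polys)

lemma polys_add: "p \<in> polys V \<Longrightarrow> q \<in> polys V \<Longrightarrow> p + q \<in> polys V"
  using keys_add[of p q] by (auto simp: in_polys)

lemma polys_uminus: "p \<in> polys V \<Longrightarrow> - p \<in> polys V"
  by (auto simp: in_polys in_keys_iff)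

lemma polys_diff: "p \<in> polys V \<Longrightarrow> q \<in> polys V \<Longrightarrow> p - q \<in> polys V"
  using polys_add[of p V "- q"] polys_uminus[of q V] by simp

lemma polys_pscale: "p \<in> polys V \<Longrightarrow> pscale c p \<in> polys V"
  using keys_pscale[of c p] by (auto simp: in_polys)

lemma polys_mult: "p \<in> polys V \<Longrightarrow> q \<in> polys V \<Longrightarrow> p * q \<in> polys V"
  unfolding in_polys
proof
  fix e assume *: "\<forall>e\<in>keys p. keys e \<subseteq> V" "\<forall>e\<in>keys q. keys e \<subseteq> V" "e \<in> keys (p * q)"
  then obtain a b where "e = a + b" "a \<in> keys p" "b \<in> keys q"
    using keys_mult[of p q] by blast
  thus "keys e \<subseteq> V" using * keys_add[of a b] by blast
qed

lemma polys_single: "keys e \<subseteq> V \<Longrightarrow> single e c \<in> polys V"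
  by (simp add: in_polys)

lemma polys_mono: "U \<subseteq> V \<Longrightarrow> polys U \<subseteq> polys V"
  by (fastforce simp: in_polys)

lemma subspace_polys: "vs.subspace (polys V)"
  by (rule vs.subspaceI) (auto simp: polys_add polys_pscale)

lemma cring_mpoly_ring: "cring (mpoly_ring V)"
proof (rule cringI)
  show "abelian_group (mpoly_ring V)"
  proof (rule abelian_groupI, goal_cases)
    case (6 x)
    thus ?case by (intro bexI[of _ "- x"]) (simp_all add: polys_uminus)
  qed (simp_all add: polys_add add_ac)
  show "comm_monoid (mpoly_ring V)"
    by (rule comm_monoidI) (simp_all add: polys_mult mult_ac)
qed (simp add: distrib_right)

lemma ring_mpoly_ring: "ring (mpoly_ring V)"
  using cring_mpoly_ring cring.axioms(1) by blast

text \<open>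
  Polynomials are sums of monomials, so stability under multiplication need only be checked for
  these. Negatives come from the constant monomial \<open>-1\<close>.
\<close>

lemma ideal_mpolyI:
  assumes "I \<subseteq> polys V" "0 \<in> I" "\<And>p q. p \<in> I \<Longrightarrow> q \<in> I \<Longrightarrow> p + q \<in> I"
    and mono: "\<And>p e c. p \<in> I \<Longrightarrow> keys e \<subseteq> V \<Longrightarrow> single e c * p \<in> I"
  shows "ideal I (mpoly_ring V)"
proof (rule idealI)
  have sum: "sum f A \<in> I" if "\<And>x. x \<in> A \<Longrightarrow> f x \<in> I" for f and A :: "(nat \<Rightarrow>\<^sub>0 nat) set"
    using that by (induction A rule: infinite_finite_induct) (auto simp: assms)
  have mult: "x * p \<in> I" if "p \<in> I" "x \<in> polys V" for p x
  proof -
    have "(\<Sum>e\<in>keys x. single e (lookup x e)) * p \<in> I"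
      unfolding sum_distrib_right by (rule sum) (use that in \<open>auto simp: in_polys intro: mono\<close>)
    thus ?thesis by (simp add: sum_singles)
  qed
  show "ring (mpoly_ring V :: 'a mpoly ring)" by (rule ring_mpoly_ring)
  interpret R: ring "mpoly_ring V :: 'a mpoly ring" by (rule ring_mpoly_ring)
  show "subgroup I (add_monoid (mpoly_ring V))"
  proof (rule R.add.subgroupI)
    fix p assume p: "p \<in> I"
    have "- p \<in> I" using mono[OF p, of 0 "-1"] by (simp add: single_uminus)
    moreover have "\<ominus>\<^bsub>mpoly_ring V\<^esub> p = - p"
      using p assms(1) by (intro R.minus_equality) (auto intro: polys_uminus)
    ultimately show "\<ominus>\<^bsub>mpoly_ring V\<^esub> p \<in> I" by simp
  qed (use assms in auto)
  show "x \<otimes>\<^bsub>mpoly_ring V\<^esub> p \<in> I" "p \<otimes>\<^bsub>mpoly_ring V\<^esub> x \<in> I"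
    if "p \<in> I" "x \<in> polys V" for p x
    using mult[OF that] by (simp_all add: mult.commute)
qed

lemma ideal_mpolyD:
  assumes "ideal I (mpoly_ring V)"
  shows "I \<subseteq> polys V" "0 \<in> I" "p \<in> I \<Longrightarrow> q \<in> I \<Longrightarrow> p + q \<in> I"
    "p \<in> I \<Longrightarrow> x \<in> polys V \<Longrightarrow> x * p \<in> I"
    "p \<in> I \<Longrightarrow> q \<in> I \<Longrightarrow> p - q \<in> I" "p \<in> I \<Longrightarrow> pscale c p \<in> I"
proof -
  interpret ideal I "mpoly_ring V" by fact
  show sub: "I \<subseteq> polys V" using a_subset by auto
  show "0 \<in> I" using additive_subgroup.zero_closed[OF is_additive_subgroup] by simp
  show add: "p + q \<in> I" if "p \<in> I" "q \<in> I" for p q using additive_subgroup.a_closed[OF is_additive_subgroup that] by simp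
  show mult: "x * p \<in> I" if "p \<in> I" "x \<in> polys V" for p x
    using I_l_closed[OF that] by simp
  show sc: "pscale c p \<in> I" if "p \<in> I" for p c
    using mult[OF that, of "single 0 c"] by (simp add: pscale_eq_mult polys_single)
  show "p - q \<in> I" if "p \<in> I" "q \<in> I" for p q
    using add[OF that(1) sc[OF that(2), of "-1"]] by (simp add: pscale_eq_mult single_uminus)
qed

lemma subspace_ideal: "ideal I (mpoly_ring V) \<Longrightarrow> vs.subspace I"
  by (rule vs.subspaceI) (fact ideal_mpolyD)+

lemma genideal_mpoly:
  assumes "S \<subseteq> polys V"
  shows "ideal (genideal (mpoly_ring V) S) (mpoly_ring V)" "S \<subseteq> genideal (mpoly_ring V) S"
    "ideal I (mpoly_ring V) \<Longrightarrow> S \<subseteq> I \<Longrightarrow> genideal (mpoly_ring V) S \<subseteq> I"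
  by (rule ring.genideal_ideal[OF ring_mpoly_ring assms])
    (rule ring.genideal_self[OF ring_mpoly_ring assms], rule ring.genideal_minimal[OF ring_mpoly_ring])

section \<open>Monomial maps and their kernels\<close>

text \<open>
  The linear map that replaces each monomial \<open>x\<^sup>e\<close> by the monomial with exponent \<open>g e\<close>. Besides additive
  \<open>g\<close>, for which it is a ring homomorphism, the maps \<open>g\<close> that choose representatives of a partition of
  the exponents are of interest: the coefficients of \<open>push g p\<close> are then the sums of the coefficients
  of \<open>p\<close> over the classes.
\<close>

definition push :: "((nat \<Rightarrow>\<^sub>0 nat) \<Rightarrow> (nat \<Rightarrow>\<^sub>0 nat)) \<Rightarrow> 'k::field mpoly \<Rightarrow> 'k mpoly" where
  "push g = lext (\<lambda>e. xpow (g e))"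

definition push_ker :: "((nat \<Rightarrow>\<^sub>0 nat) \<Rightarrow> (nat \<Rightarrow>\<^sub>0 nat)) \<Rightarrow> nat set \<Rightarrow> 'k::field mpoly set" where
  "push_ker g V = {p \<in> polys V. push g p = 0}"

lemma push_simps: "push g 0 = 0" "push g (p + q) = push g p + push g q"
  "push g (p - q) = push g p - push g q"
  "push g (pscale c p) = pscale c (push g p)" "push g (single e c) = single (g e) c"
  by (simp_all add: push_def lext_add lext_diff lext_pscale)

lemma push_push: "push g (push h p) = push (g \<circ> h) p"
  by (simp add: push_def lext_lext)

text \<open>
  If \<open>g\<close> separates at least as much as \<open>h\<close>, then \<open>h\<close> factors through \<open>g\<close>. This is how two kernels are
  compared throughout.
\<close>

lemma push_factor:
  assumes "\<And>e e'. e \<in> keys p \<Longrightarrow> e' \<in> keys p \<Longrightarrow> g e = g e' \<Longrightarrow> h e = h e'" "push g p = 0"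
  shows "push h p = 0"
proof -
  define \<tau> where "\<tau> b = h (SOME e. e \<in> keys p \<and> g e = b)" for b
  have "\<tau> (g e) = h e" if "e \<in> keys p" for e
  proof -
    have "(SOME e'. e' \<in> keys p \<and> g e' = g e) \<in> keys p \<and> g (SOME e'. e' \<in> keys p \<and> g e' = g e) = g e"
      by (rule someI[of _ e]) (use that in auto)
    thus ?thesis using assms(1) that unfolding \<tau>_def by blast
  qed
  hence "push h p = push (\<tau> \<circ> g) p"
    unfolding push_def by (intro lext_cong) simp
  also have "\<dots> = push \<tau> (push g p)" by (simp add: push_push)
  finally show ?thesis by (simp add: assms(2) push_simps)
qed

lemma push_single_mult: "push g (single e c * p) = pscale c (push (\<lambda>e'. g (e + e')) p)"
proof -
  have "single e c * p = single e c * (\<Sum>e'\<in>keys p. single e' (lookup p e'))"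
    by (simp add: sum_singles)
  thus ?thesis
    by (simp add: sum_distrib_left mult_single push_def lext_sum pscale_sum lext_def[of _ p])
qed

text \<open>
  The hypothesis says that the fibres of \<open>g\<close> form a congruence on the exponents. This is weaker than
  additivity, as required for the classes modulo a rational subspace below.
\<close>

lemma ideal_push_ker:
  assumes "\<And>e e' e''. g e' = g e'' \<Longrightarrow> g (e + e') = g (e + e'')"
  shows "ideal (push_ker g V) (mpoly_ring V)"
proof (rule ideal_mpolyI)
  fix p :: "'a mpoly" and e :: "nat \<Rightarrow>\<^sub>0 nat" and c assume *: "p \<in> push_ker g V" "keys e \<subseteq> V"
  have "push (\<lambda>e'. g (e + e')) p = 0"
    by (rule push_factor[of p g, OF assms]) (use * in \<open>simp_all add: push_ker_def\<close>)
  thus "single e c * p \<in> push_ker g V"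
    using * by (simp add: push_ker_def push_single_mult polys_mult polys_single)
qed (auto simp: push_ker_def push_simps polys_add)

lemma push_mult:
  assumes "\<And>e e'. g (e + e') = g e + g e'"
  shows "push g (p * q) = push g p * push g q"
  unfolding push_def by (rule lext_mult) (simp add: assms mult_single)

text \<open>
  For additive \<open>g\<close> the set is the kernel of a homomorphism into a polynomial ring, which is a domain.
\<close>

lemma primeideal_push_ker:
  assumes "\<And>e e'. g (e + e') = g e + g e'"
  shows "primeideal (push_ker g V) (mpoly_ring V)"
proof (rule primeidealI)
  show "ideal (push_ker g V) (mpoly_ring V)"
    by (rule ideal_push_ker) (simp add: assms)
  show "cring (mpoly_ring V)" by (rule cring_mpoly_ring)
  have "(1 :: 'a mpoly) \<notin> push_ker g V"
  proof
    assume "(1 :: 'a mpoly) \<in> push_ker g V"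
    hence "single (g 0) (1 :: 'a) = 0"
      using push_simps(5)[of g 0 "1::'a"] by (simp add: push_ker_def)
    hence "lookup (single (g 0) (1 :: 'a)) (g 0) = 0" by (simp only: lookup_zero)
    thus False by simp
  qed
  thus "polys V \<noteq> (push_ker g V :: 'a mpoly set)" using polys_1[of V] by metis
next
  fix p q :: "'a mpoly"
  assume "p \<in> polys V" "q \<in> polys V" "p \<otimes>\<^bsub>mpoly_ring V\<^esub> q \<in> push_ker g V"
  thus "p \<in> push_ker g V \<or> q \<in> push_ker g V"
    by (simp add: push_ker_def push_mult[OF assms])
qed

section \<open>The relation space of a family of exponent vectors\<close>

definition toric :: "(nat \<Rightarrow> (nat \<Rightarrow>\<^sub>0 nat)) \<Rightarrow> nat set \<Rightarrow> 'k::field mpoly set" where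
  "toric a V = push_ker (lext a) V"

definition ratv :: "('a \<Rightarrow>\<^sub>0 nat) \<Rightarrow> ('a \<Rightarrow>\<^sub>0 rat)" where
  "ratv e = Poly_Mapping.map of_nat e"

definition relspace :: "(nat \<Rightarrow> (nat \<Rightarrow>\<^sub>0 nat)) \<Rightarrow> nat set \<Rightarrow> (nat \<Rightarrow>\<^sub>0 rat) set" where
  "relspace a V = {u. keys u \<subseteq> V \<and> lext (ratv \<circ> a) u = 0}"

definition rel_pairs :: "(nat \<Rightarrow> (nat \<Rightarrow>\<^sub>0 nat)) \<Rightarrow> nat set \<Rightarrow> ((nat \<Rightarrow>\<^sub>0 nat) \<times> (nat \<Rightarrow>\<^sub>0 nat)) set" where
  "rel_pairs a V = {(u, v). keys u \<subseteq> V \<and> keys v \<subseteq> V \<and> lext a u = lext a v}"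

definition xbinom :: "(nat \<Rightarrow>\<^sub>0 nat) \<times> (nat \<Rightarrow>\<^sub>0 nat) \<Rightarrow> 'k::field mpoly" where
  "xbinom z = xpow (fst z) - xpow (snd z)"

definition expdiff :: "('a \<Rightarrow>\<^sub>0 nat) \<times> ('a \<Rightarrow>\<^sub>0 nat) \<Rightarrow> ('a \<Rightarrow>\<^sub>0 rat)" where
  "expdiff z = ratv (fst z) - ratv (snd z)"

lemma lookup_ratv [simp]: "lookup (ratv e) j = of_nat (lookup e j)"
  by (simp add: ratv_def map.rep_eq when_def)

lemma keys_ratv [simp]: "keys (ratv e) = keys e"
  by (auto simp: in_keys_iff)

lemma ratv_add: "ratv (e + e') = ratv e + ratv e'"
  by (rule poly_mapping_eqI) (simp add: lookup_add)

lemma ratv_eq_iff [simp]: "ratv e = ratv e' \<longleftrightarrow> e = e'"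
proof
  assume "ratv e = ratv e'"
  hence "lookup (ratv e) j = lookup (ratv e') j" for j by simp
  thus "e = e'" by (intro poly_mapping_eqI) simp
qed simp

lemma ratv_lext: "ratv (lext a e) = lext (ratv \<circ> a) (ratv e)"
  by (rule poly_mapping_eqI) (simp add: lookup_lext)

lemma primeideal_toric: "primeideal (toric a V) (mpoly_ring V)"
  unfolding toric_def by (rule primeideal_push_ker) (rule lext_add)

lemma ideal_toric: "ideal (toric a V) (mpoly_ring V)"
  using primeideal_toric primeideal.axioms(1) by blast

lemma toric_subset_polys: "toric a V \<subseteq> polys V"
  by (auto simp: toric_def push_ker_def)

lemma keys_diff_subset: "keys (p - q :: 'a \<Rightarrow>\<^sub>0 'k::ab_group_add) \<subseteq> keys p \<union> keys q"
  by (auto simp: in_keys_iff lookup_minus)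

lemma subspace_relspace: "vs.subspace (relspace a V)"
proof (rule vs.subspaceI)
  fix x y assume "x \<in> relspace a V" "y \<in> relspace a V"
  thus "x + y \<in> relspace a V"
    using keys_add[of x y] by (auto simp: relspace_def lext_add)
next
  fix c x assume "x \<in> relspace a V"
  thus "pscale c x \<in> relspace a V"
    using keys_pscale[of c x] by (auto simp: relspace_def lext_pscale)
qed (simp add: relspace_def)

lemma expdiff_in_relspace:
  assumes "keys u \<subseteq> V" "keys v \<subseteq> V"
  shows "expdiff (u, v) \<in> relspace a V \<longleftrightarrow> lext a u = lext a v"
proof -
  have "lext (ratv \<circ> a) (expdiff (u, v)) = ratv (lext a u) - ratv (lext a v)"
    by (simp add: expdiff_def lext_diff ratv_lext)
  moreover have "keys (expdiff (u, v)) \<subseteq> V"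
    using keys_diff_subset[of "ratv u" "ratv v"] assms by (auto simp: expdiff_def)
  ultimately show ?thesis by (simp add: relspace_def)
qed

lemma expdiff_rel_pairs: "z \<in> rel_pairs a V \<Longrightarrow> expdiff z \<in> relspace a V"
  by (auto simp: rel_pairs_def expdiff_in_relspace)

lemma push_xbinom: "push g (xbinom (u, v)) = xpow (g u) - xpow (g v)"
  by (simp add: xbinom_def push_simps)

lemma xpow_eq_iff [simp]: "(xpow e :: 'k::field mpoly) = xpow e' \<longleftrightarrow> e = e'"
  by (metis keys_single singleton_insert_inj_eq zero_neq_one)

lemma xbinom_in_toric:
  assumes "keys u \<subseteq> V" "keys v \<subseteq> V"
  shows "(xbinom (u, v) :: 'k::field mpoly) \<in> toric a V \<longleftrightarrow> lext a u = lext a v"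
proof -
  have "(xbinom (u, v) :: 'k mpoly) \<in> polys V"
    using assms by (auto simp: xbinom_def intro!: polys_diff polys_single)
  thus ?thesis by (simp add: toric_def push_ker_def push_xbinom)
qed

lemma xbinom_rel_pairs: "xbinom ` rel_pairs a V \<subseteq> toric a V"
  by (auto simp: rel_pairs_def xbinom_in_toric)

text \<open>
  Choose one exponent in each fibre of \<open>lext a\<close> and call the choice \<open>\<tau>\<close>. For \<open>p\<close> in the ideal the
  coefficients sum to zero over every fibre, so \<open>push \<tau> p = 0\<close> may be subtracted from \<open>p\<close>; this turns every
  monomial of \<open>p\<close> into a binomial.
\<close>

lemma toric_eq_span_binomials: "toric a V = vs.span (xbinom ` rel_pairs a V :: 'k::field mpoly set)"
proof
  show "vs.span (xbinom ` rel_pairs a V) \<subseteq> (toric a V :: 'k mpoly set)"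
    by (rule vs.span_minimal[OF xbinom_rel_pairs subspace_ideal[OF ideal_toric]])
  show "toric a V \<subseteq> vs.span (xbinom ` rel_pairs a V :: 'k mpoly set)"
  proof
    fix p :: "'k mpoly" assume p: "p \<in> toric a V"
    define \<tau> where "\<tau> e = (SOME e'. keys e' \<subseteq> V \<and> lext a e' = lext a e)" for e
    have \<tau>: "keys (\<tau> e) \<subseteq> V \<and> lext a (\<tau> e) = lext a e" if "keys e \<subseteq> V" for e
      unfolding \<tau>_def by (rule someI[of _ e]) (use that in simp)
    have "push \<tau> p = 0"
      by (rule push_factor[of p "lext a"]) (use p in \<open>auto simp: toric_def push_ker_def \<tau>_def\<close>)
    hence "p = p - push \<tau> p" by simp
    also have "\<dots> = lext (\<lambda>e. xbinom (e, \<tau> e)) p"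
    proof -
      have "p - push \<tau> p = lext xpow p - lext (\<lambda>e. xpow (\<tau> e)) p"
        by (simp add: push_def)
      thus ?thesis
        by (simp only: lext_def xbinom_def vs.scale_right_diff_distrib sum_subtractf fst_conv snd_conv)
    qed
    also have "\<dots> \<in> vs.span (xbinom ` rel_pairs a V)"
    proof (rule lext_mem_subspace[OF vs.subspace_span])
      fix e assume "e \<in> keys p"
      hence "keys e \<subseteq> V" using p toric_subset_polys[of a V] by (fastforce simp: in_polys)
      thus "(xbinom (e, \<tau> e) :: 'k mpoly) \<in> vs.span (xbinom ` rel_pairs a V)"
        using \<tau>[of e] by (intro vs.span_base imageI) (auto simp: rel_pairs_def)
    qed
    finally show "p \<in> vs.span (xbinom ` rel_pairs a V)" .
  qed
qed

lemma common_denominator: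
  fixes f :: "'a \<Rightarrow> rat"
  assumes "finite S"
  shows "\<exists>N::nat. N > 0 \<and> (\<forall>j\<in>S. of_nat N * f j \<in> \<int>)"
  using assms
proof (induction S)
  case empty
  show ?case by (intro exI[of _ 1]) simp
next
  case (insert x S)
  then obtain N :: nat where N: "N > 0" "\<forall>j\<in>S. of_nat N * f j \<in> \<int>" by blast
  obtain c d :: int where cd: "f x = Rat.Fract c d" "d > 0" by (cases "f x" rule: Rat_cases) auto
  have "of_nat (nat d) * f x = of_int c" using cd by (simp add: Fract_of_int_quotient)
  hence "of_nat (N * nat d) * f x = of_int (int N * c)" by (simp add: mult.assoc)
  moreover have "of_nat (N * nat d) * f j = of_nat (nat d) * (of_nat N * f j)" for j by simp
  ultimately have "\<forall>j\<in>insert x S. of_nat (N * nat d) * f j \<in> \<int>"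
    using N(2) by (metis Ints_mult Ints_of_int Ints_of_nat insert_iff)
  thus ?case using N(1) cd(2) by (intro exI[of _ "N * nat d"]) simp
qed

text \<open>
  Split an integral multiple of \<open>u\<close> into its positive and negative parts.
\<close>

lemma clear_denominators:
  assumes "u \<in> relspace a V"
  obtains N :: nat and z where "N > 0" "z \<in> rel_pairs a V" "expdiff z = pscale (of_nat N) u"
proof -
  obtain N :: nat where N: "N > 0" "\<forall>j\<in>keys u. of_nat N * lookup u j \<in> \<int>"
    using common_denominator[of "keys u" "lookup u"] by auto
  define w where "w j = \<lfloor>of_nat N * lookup u j\<rfloor>" for j
  have w: "of_int (w j) = of_nat N * lookup u j" if "j \<in> keys u" for j
    using N(2) that unfolding w_def by (metis Ints_cases floor_of_int)
  define x y :: "nat \<Rightarrow>\<^sub>0 nat" where "x = (\<Sum>j\<in>keys u. single j (nat (w j)))"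
    and "y = (\<Sum>j\<in>keys u. single j (nat (- w j)))"
  have lk: "lookup x j = (if j \<in> keys u then nat (w j) else 0)"
    "lookup y j = (if j \<in> keys u then nat (- w j) else 0)" for j
    by (simp_all add: x_def y_def lookup_sum lookup_single when_def)
  have "expdiff (x, y) = pscale (of_nat N) u"
  proof (rule poly_mapping_eqI)
    fix j
    have "rat_of_nat (nat (w j)) - of_nat (nat (- w j)) = of_int (w j)"
      by (cases "w j \<ge> 0") auto
    thus "lookup (expdiff (x, y)) j = lookup (pscale (of_nat N) u) j"
      using w[of j] by (auto simp: expdiff_def lookup_minus lk in_keys_iff)
  qed
  moreover have "keys x \<subseteq> V" "keys y \<subseteq> V"
    using assms by (auto simp: relspace_def in_keys_iff lk split: if_splits)
  moreover have "pscale (of_nat N) u \<in> relspace a V"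
    by (rule vs.subspace_scale[OF subspace_relspace assms])
  ultimately have "(x, y) \<in> rel_pairs a V"
    using expdiff_in_relspace[of x V y a] by (auto simp: rel_pairs_def)
  thus ?thesis using that N(1) \<open>expdiff (x, y) = _\<close> by blast
qed

lemma relspace_subset_span: "relspace a V \<subseteq> vs.span (expdiff ` rel_pairs a V)"
proof
  fix u assume "u \<in> relspace a V"
  then obtain N :: nat and z where *: "N > 0" "z \<in> rel_pairs a V" "expdiff z = pscale (of_nat N) u"
    by (rule clear_denominators)
  hence "u = pscale (1 / of_nat N) (expdiff z)" by simp
  thus "u \<in> vs.span (expdiff ` rel_pairs a V)"
    using *(2) by (metis imageI vs.span_base vs.span_scale)
qed

section \<open>Pivot coordinates of a finite-dimensional subspace\<close>

lemma lookup_eq_0: "keys u \<subseteq> V \<Longrightarrow> j \<notin> V \<Longrightarrow> lookup u j = 0"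
  by (auto simp: in_keys_iff)

text \<open>
  Gaussian elimination. The list \<open>js\<close> collects pivots: the subspaces of \<open>S\<close> on which the first \<open>i\<close> pivot
  coordinates vanish decrease strictly with \<open>i\<close> and reach zero, and there are as many pivots as basis
  vectors. The strictness produces a long chain of primes, the zero at the end produces independent
  variables.
\<close>

lemma pivot_coordinates:
  fixes S :: "(nat \<Rightarrow>\<^sub>0 'k::field) set"
  assumes "finite V" "vs.subspace S" "S \<subseteq> {u. keys u \<subseteq> V}"
  shows "\<exists>js B. distinct js \<and> set js \<subseteq> V \<and> vs.independent B \<and> finite B \<and> card B = length js \<and>
           B \<subseteq> S \<and> S \<subseteq> vs.span B \<and>
           (\<forall>i<length js. \<exists>u\<in>S. (\<forall>j\<in>set (take i js). lookup u j = 0) \<and> lookup u (js ! i) \<noteq> 0) \<and>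
           (\<forall>u\<in>S. (\<forall>j\<in>set js. lookup u j = 0) \<longrightarrow> u = 0)"
  using assms
proof (induction V arbitrary: S)
  case empty
  hence "u = 0" if "u \<in> S" for u using that by (intro poly_mapping_eqI) (auto intro: lookup_eq_0)
  thus ?case by (intro exI[of _ "[]"] exI[of _ "{}"]) (auto simp: vs.independent_empty)
next
  case (insert v V S)
  define S' where "S' = {u \<in> S. lookup u v = 0}"
  have sub: "vs.subspace S'"
    using insert.prems(1) unfolding S'_def vs.subspace_def by (auto simp: lookup_add)
  have "S' \<subseteq> {u. keys u \<subseteq> V}"
    using insert.prems(2) by (auto simp: S'_def in_keys_iff)
  from insert.IH[OF sub this] obtain js B where *: "distinct js" "set js \<subseteq> V" "vs.independent B"
    "finite B" "card B = length js" "B \<subseteq> S'" "S' \<subseteq> vs.span B"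
    and lt: "\<forall>i<length js. \<exists>u\<in>S'. (\<forall>j\<in>set (take i js). lookup u j = 0) \<and> lookup u (js ! i) \<noteq> 0"
    and z: "\<forall>u\<in>S'. (\<forall>j\<in>set js. lookup u j = 0) \<longrightarrow> u = 0"
    by blast
  show ?case
  proof (cases "S' = S")
    case True
    show ?thesis
      by (rule exI[of _ js], rule exI[of _ B]) (use * lt z True in auto)
  next
    case False
    then obtain u0 where u0: "u0 \<in> S" "lookup u0 v \<noteq> 0" unfolding S'_def by blast
    have B0: "lookup u v = 0" if "u \<in> vs.span B" for u
    proof -
      have "u \<in> S'" using that vs.span_minimal[OF *(6) sub] by blast
      thus ?thesis by (simp add: S'_def)
    qed
    hence u0B: "u0 \<notin> vs.span B" using u0(2) by blast
    have ind: "vs.independent (insert u0 B)" using vs.independent_insertI[OF u0B *(3)] .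
    have card: "card (insert u0 B) = length (v # js)"
      using *(4,5) u0B vs.span_base by (subst card_insert_disjoint) auto
    have span: "S \<subseteq> vs.span (insert u0 B)"
    proof
      fix u assume u: "u \<in> S"
      define c where "c = lookup u v / lookup u0 v"
      have "u - pscale c u0 \<in> S'"
        using u u0 insert.prems(1)
        by (auto simp: S'_def c_def lookup_minus intro!: vs.subspace_diff vs.subspace_scale)
      thus "u \<in> vs.span (insert u0 B)" using *(7) vs.span_breakdown_eq by blast
    qed
    have lt': "\<exists>u\<in>S. (\<forall>j\<in>set (take i (v # js)). lookup u j = 0) \<and> lookup u ((v # js) ! i) \<noteq> 0"
      if i: "i < length (v # js)" for i
    proof (cases i)
      case 0
      thus ?thesis using u0 by auto
    next
      case (Suc k)
      then obtain u where "u \<in> S'" "\<forall>j\<in>set (take k js). lookup u j = 0" "lookup u (js ! k) \<noteq> 0"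
        using lt i by auto
      thus ?thesis using Suc by (intro bexI[of _ u]) (auto simp: S'_def)
    qed
    show ?thesis
      by (rule exI[of _ "v # js"], rule exI[of _ "insert u0 B"])
        (use *(1,2,4,6) insert.hyps(2) u0(1) ind card span lt' z in \<open>auto simp: S'_def\<close>)
  qed
qed

text \<open>
  The ambient space of all finitely supported functions is infinite-dimensional, so finiteness has
  to come from a basis of \<open>S\<close>, and the pivots provide a finite one.
\<close>

lemma card_le_dim:
  fixes S :: "(nat \<Rightarrow>\<^sub>0 'k::field) set"
  assumes "finite V" "vs.subspace S" "S \<subseteq> {u. keys u \<subseteq> V}" "C \<subseteq> S" "vs.independent C"
  shows "finite C \<and> card C \<le> vs.dim S"
proof -
  from pivot_coordinates[OF assms(1-3)] obtain B where *: "vs.independent B" "finite B"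
    "B \<subseteq> S" "S \<subseteq> vs.span B" by blast
  thus ?thesis
    using vs.independent_span_bound[OF *(2) assms(5)] assms(4) vs.basis_card_eq_dim[OF *(3,4,1)]
    by auto
qed

section \<open>Substitution of polynomials\<close>

definition monom_eval :: "(nat \<Rightarrow> 'k::field mpoly) \<Rightarrow> (nat \<Rightarrow>\<^sub>0 nat) \<Rightarrow> 'k mpoly" where
  "monom_eval f e = (\<Prod>j\<in>keys e. f j ^ lookup e j)"

lemma mpoly_subst_eq_lext: "mpoly_subst f = lext (monom_eval f)"
  by (rule ext) (simp add: mpoly_subst_def lext_def monom_eval_def pscale_eq_mconst)

lemma monom_eval_superset:
  assumes "finite S" "keys e \<subseteq> S"
  shows "monom_eval f e = (\<Prod>j\<in>S. f j ^ lookup e j)"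
  unfolding monom_eval_def by (rule prod.mono_neutral_left) (use assms in \<open>auto simp: in_keys_iff\<close>)

lemma monom_eval_add: "monom_eval f (e + e') = monom_eval f e * monom_eval f e'"
proof -
  have "keys (e + e') \<subseteq> keys e \<union> keys e'" by (rule keys_add)
  thus ?thesis
    by (simp add: monom_eval_superset[of "keys e \<union> keys e'"] lookup_add power_add prod.distrib)
qed

lemma mpoly_subst_mult: "mpoly_subst f (p * q) = mpoly_subst f p * mpoly_subst f q"
  unfolding mpoly_subst_eq_lext by (rule lext_mult) (rule monom_eval_add)

lemma xpow_power: "xpow u ^ k = xpow (pscale k u)"
proof (induction k)
  case (Suc k)
  have "pscale (Suc k) u = u + pscale k u"
    by (rule poly_mapping_eqI) (simp add: lookup_add)
  thus ?case using Suc by (simp add: mult_single)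
qed simp

lemma prod_xpow: "(\<Prod>j\<in>A. xpow (u j)) = xpow (\<Sum>j\<in>A. u j)"
  by (induction A rule: infinite_finite_induct) (simp_all add: mult_single)

text \<open>
  Substituting monomials for the variables is a monomial map; this covers the toric homomorphism as
  well as the identity.
\<close>

lemma monom_eval_xpow: "monom_eval (\<lambda>j. xpow (b j)) e = xpow (lext b e)"
  by (simp add: monom_eval_def xpow_power prod_xpow lext_def)

lemma mpoly_subst_xpow: "mpoly_subst (\<lambda>j. xpow (b j)) = push (lext b)"
  by (simp add: mpoly_subst_eq_lext push_def monom_eval_xpow[abs_def])

lemma mpoly_subst_mvar: "mpoly_subst mvar p = p"
proof -
  have "mpoly_subst mvar p = push (lext (\<lambda>j. single j 1)) p"
    unfolding mvar_def[abs_def] mpoly_subst_xpow ..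
  thus ?thesis by (simp only: push_def lext_ident)
qed

lemma polys_prod: "(\<And>j. j \<in> A \<Longrightarrow> f j \<in> polys V) \<Longrightarrow> prod f A \<in> polys V"
  by (induction A rule: infinite_finite_induct) (simp_all add: polys_mult)

lemma polys_power: "p \<in> polys V \<Longrightarrow> p ^ k \<in> polys V"
  by (induction k) (simp_all add: polys_mult)

lemma mpoly_subst_in_polys:
  assumes "F \<in> polys J" "\<And>j. j \<in> J \<Longrightarrow> f j \<in> polys V"
  shows "mpoly_subst f F \<in> polys V"
  unfolding mpoly_subst_eq_lext monom_eval_def
proof (rule lext_mem_subspace[OF subspace_polys])
  fix e assume "e \<in> keys F"
  hence "keys e \<subseteq> J" using assms(1) by (auto simp: in_polys)
  thus "(\<Prod>j\<in>keys e. f j ^ lookup e j) \<in> polys V"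
    using assms(2) by (intro polys_prod polys_power) auto
qed

section \<open>Algebraic independence modulo an ideal\<close>

text \<open>
  The family \<open>f\<close>, indexed by \<open>J\<close>, is algebraically independent over \<open>k\<close> modulo \<open>Q\<close>. The indices double
  as the variables of the polynomials \<open>F\<close>.
\<close>

definition alg_indep :: "nat set \<Rightarrow> 'k::field mpoly set \<Rightarrow> (nat \<Rightarrow> 'k mpoly) \<Rightarrow> bool" where
  "alg_indep J Q f \<longleftrightarrow> (\<forall>F\<in>polys J. mpoly_subst f F \<in> Q \<longrightarrow> F = 0)"

lemma keys_empty_imp_0: "keys p = {} \<Longrightarrow> p = 0"
  by (rule poly_mapping_eqI) (auto simp: in_keys_iff)

lemma mult_lext:
  fixes q :: "'b::comm_monoid_add \<Rightarrow>\<^sub>0 'k::comm_semiring_1"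
  shows "q * lext h p = lext (\<lambda>e. q * h e) p"
  by (simp add: lext_def sum_distrib_left mult_pscale)

lemma lext_fun_add: "lext (\<lambda>e. h e + h' e) p = lext h p + lext h' p"
  by (simp add: lext_def pscale_add sum.distrib)

text \<open>
  Division by the variable \<open>s\<close> with remainder, in a form suited to induction on the degree in \<open>s\<close>.
\<close>

lemma split_variable:
  fixes F :: "'k::field mpoly"
  assumes "F \<in> polys (insert s J)" "s \<notin> J" "\<And>e. e \<in> keys F \<Longrightarrow> lookup e s < Suc N"
  obtains F0 F1 where "F = F0 + mvar s * F1" "F0 \<in> polys J" "F1 \<in> polys (insert s J)"
    "\<And>e. e \<in> keys F1 \<Longrightarrow> lookup e s < N"
proof
  define h0 :: "_ \<Rightarrow> 'k mpoly" where "h0 e = (if lookup e s = 0 then xpow e else 0)" for e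
  define h1 :: "_ \<Rightarrow> 'k mpoly"
    where "h1 e = (if lookup e s = 0 then 0 else xpow (e - single s 1))" for e
  have "h0 e + mvar s * h1 e = xpow e" for e
  proof (cases "lookup e s = 0")
    case False
    have "single s 1 + (e - single s 1) = e"
      by (rule poly_mapping_eqI) (use False in \<open>auto simp: lookup_add lookup_minus lookup_single when_def\<close>)
    thus ?thesis using False by (simp add: h0_def h1_def mvar_def mult_single)
  qed (simp add: h0_def h1_def)
  hence "lext h0 F + mvar s * lext h1 F = lext xpow F"
    by (simp add: mult_lext flip: lext_fun_add)
  thus "F = lext h0 F + mvar s * lext h1 F" by simp
  show "lext h0 F \<in> polys J"
  proof (rule lext_mem_subspace[OF subspace_polys])
    fix e assume "e \<in> keys F"
    hence "keys e \<subseteq> insert s J" using assms(1) by (auto simp: in_polys)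
    thus "h0 e \<in> polys J" by (auto simp: h0_def in_keys_iff intro!: polys_single)
  qed
  have *: "\<exists>e0\<in>keys F. lookup e0 s \<noteq> 0 \<and> e = e0 - single s 1" if "e \<in> keys (lext h1 F)" for e
    using that keys_lext[of h1 F] by (force simp: h1_def split: if_splits)
  show "lookup e s < N" if "e \<in> keys (lext h1 F)" for e
    using *[OF that] assms(3) by (fastforce simp: lookup_minus)
  show "lext h1 F \<in> polys (insert s J)"
  proof (unfold in_polys, rule ballI)
    fix e assume "e \<in> keys (lext h1 F)"
    then obtain e0 where e0: "e0 \<in> keys F" "e = e0 - single s 1" using * by blast
    hence "keys e \<subseteq> keys e0" by (auto simp: in_keys_iff lookup_minus)
    thus "keys e \<subseteq> insert s J" using e0(1) assms(1) by (auto simp: in_polys)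
  qed
qed

text \<open>
  This is why the transcendence degree drops along an inclusion of primes. A relation
  \<open>F = F0 + s * F1\<close> between the \<open>f j\<close> and \<open>g\<close> modulo \<open>Q'\<close> becomes the relation \<open>F0\<close> between the \<open>f j\<close>
  modulo \<open>Q\<close>, since \<open>g \<in> Q\<close>; so \<open>F0 = 0\<close>. As \<open>Q'\<close> is prime and \<open>g \<notin> Q'\<close>, the factor \<open>g\<close> can be
  cancelled, and \<open>F1\<close> is a relation of smaller degree in \<open>s\<close>.
\<close>

lemma alg_indep_insert:
  fixes Q Q' :: "'k::field mpoly set"
  assumes Q': "primeideal Q' (mpoly_ring V)" and Q: "ideal Q (mpoly_ring V)" and "Q' \<subseteq> Q"
    and g: "g \<in> Q" "g \<notin> Q'"
    and J: "alg_indep J Q f" "\<And>j. j \<in> J \<Longrightarrow> f j \<in> polys V" and s: "s \<notin> J"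
  shows "alg_indep (insert s J) Q' (f(s := g))"
proof -
  let ?f = "f(s := g)"
  have gV: "g \<in> polys V" using g(1) ideal_mpolyD(1)[OF Q] by blast
  have fV: "?f j \<in> polys V" if "j \<in> insert s J" for j using that J(2) gV by auto
  have "F = 0" if "F \<in> polys (insert s J)" "\<And>e. e \<in> keys F \<Longrightarrow> lookup e s < N"
    "mpoly_subst ?f F \<in> Q'" for F N
    using that
  proof (induction N arbitrary: F)
    case 0
    thus ?case using keys_empty_imp_0[of F] by blast
  next
    case (Suc N)
    obtain F0 F1 where F: "F = F0 + mvar s * F1" "F0 \<in> polys J" "F1 \<in> polys (insert s J)"
      "\<And>e. e \<in> keys F1 \<Longrightarrow> lookup e s < N"
      using split_variable[OF Suc.prems(1) s Suc.prems(2)] by metis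
    have "mpoly_subst ?f (mvar s) = g"
      by (simp add: mpoly_subst_eq_lext mvar_def monom_eval_def)
    moreover have "mpoly_subst ?f F0 = mpoly_subst f F0"
      unfolding mpoly_subst_eq_lext monom_eval_def
    proof (rule lext_cong, rule prod.cong[OF refl])
      fix e j assume "e \<in> keys F0" "j \<in> keys e"
      hence "j \<noteq> s" using F(2) s by (auto simp: in_polys)
      thus "?f j ^ lookup e j = f j ^ lookup e j" by simp
    qed
    moreover have "mpoly_subst ?f F = mpoly_subst ?f F0 + mpoly_subst ?f (mvar s * F1)"
      unfolding F(1) by (simp add: mpoly_subst_eq_lext lext_add)
    ultimately have eq: "mpoly_subst ?f F = mpoly_subst f F0 + mpoly_subst ?f F1 * g"
      by (simp add: mpoly_subst_mult mult.commute)
    have F1V: "mpoly_subst ?f F1 \<in> polys V"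
      by (rule mpoly_subst_in_polys[OF F(3) fV])
    have "mpoly_subst f F0 = mpoly_subst ?f F - mpoly_subst ?f F1 * g" using eq by simp
    also have "\<dots> \<in> Q"
      using Suc.prems(3) \<open>Q' \<subseteq> Q\<close> by (intro ideal_mpolyD(5)[OF Q] ideal_mpolyD(4)[OF Q g(1) F1V]) blast
    finally have "F0 = 0" using J(1) F(2) by (auto simp: alg_indep_def)
    hence "mpoly_subst ?f F1 * g \<in> Q'"
      using eq Suc.prems(3) by (simp add: mpoly_subst_eq_lext del: fun_upd_apply)
    hence "mpoly_subst ?f F1 \<in> Q'"
      using primeideal.I_prime[OF Q' F1V gV] g(2) by auto
    hence "F1 = 0" using Suc.IH[OF F(3,4)] by blast
    thus ?case using F(1) \<open>F0 = 0\<close> by simp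
  qed
  moreover have "\<exists>N. \<forall>e\<in>keys F. lookup e s < N" for F :: "'k mpoly"
    using finite_nat_set_iff_bounded[of "(\<lambda>e. lookup e s) ` keys F"] by auto
  ultimately show ?thesis unfolding alg_indep_def by meson
qed

lemma alg_indep_chain:
  fixes Q :: "nat \<Rightarrow> 'k::field mpoly set"
  assumes Q: "\<And>i. i \<le> l \<Longrightarrow> primeideal (Q i) (mpoly_ring V)" "\<And>i. i < l \<Longrightarrow> Q i \<subset> Q (Suc i)"
    and J: "finite J" "alg_indep J (Q l) f" "\<And>j. j \<in> J \<Longrightarrow> f j \<in> polys V"
    and "k \<le> l"
  shows "\<exists>J' f'. finite J' \<and> card J' = card J + k \<and> alg_indep J' (Q (l - k)) f' \<and>
           (\<forall>j\<in>J'. f' j \<in> polys V)"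
  using \<open>k \<le> l\<close>
proof (induction k)
  case 0
  show ?case using J by (intro exI[of _ J] exI[of _ f]) auto
next
  case (Suc k)
  then obtain J' f' where *: "finite J'" "card J' = card J + k" "alg_indep J' (Q (l - k)) f'"
    "\<And>j. j \<in> J' \<Longrightarrow> f' j \<in> polys V" by auto
  obtain s where s: "s \<notin> J'" using *(1) ex_new_if_finite infinite_UNIV_nat by blast
  have lt: "Q (l - Suc k) \<subset> Q (l - k)"
    using Q(2)[of "l - Suc k"] Suc.prems by (simp add: Suc_diff_Suc)
  then obtain g where g: "g \<in> Q (l - k)" "g \<notin> Q (l - Suc k)" by blast
  have I: "ideal (Q (l - k)) (mpoly_ring V)" using Q(1)[of "l - k"] primeideal.axioms(1) by auto
  have "alg_indep (insert s J') (Q (l - Suc k)) (f'(s := g))"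
    by (rule alg_indep_insert[OF Q(1) I _ g *(3,4) s]) (use lt in auto)
  moreover have "(f'(s := g)) j \<in> polys V" if "j \<in> insert s J'" for j
    using that *(4) g(1) ideal_mpolyD(1)[OF I] by auto
  ultimately show ?case
    using *(1,2) s by (intro exI[of _ "insert s J'"] exI[of _ "f'(s := g)"])
      (auto simp del: fun_upd_apply)
qed

section \<open>Counting monomials\<close>

definition box :: "nat set \<Rightarrow> nat \<Rightarrow> (nat \<Rightarrow>\<^sub>0 nat) set" where
  "box V N = {e. keys e \<subseteq> V \<and> (\<forall>j. lookup e j \<le> N)}"

lemma card_box:
  assumes "finite V"
  shows "finite (box V N)" "card (box V N) = (N + 1) ^ card V"
proof -
  have lk: "lookup (\<Sum>j\<in>V. single j (h j)) i = (if i \<in> V then h i else 0)" for h :: "nat \<Rightarrow> nat" and i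
    using assms by (simp add: lookup_sum lookup_single when_def)
  have bij: "bij_betw (\<lambda>h. \<Sum>j\<in>V. single j (h j)) (V \<rightarrow>\<^sub>E {..N}) (box V N)"
  proof (rule bij_betwI[where g = "\<lambda>e. restrict (lookup e) V"])
    show "(\<lambda>h. \<Sum>j\<in>V. single j (h j)) \<in> (V \<rightarrow>\<^sub>E {..N}) \<rightarrow> box V N"
      by (auto simp: box_def lk in_keys_iff split: if_splits)
    show "(\<lambda>e. restrict (lookup e) V) \<in> box V N \<rightarrow> (V \<rightarrow>\<^sub>E {..N})"
      by (auto simp: box_def)
    show "restrict (lookup (\<Sum>j\<in>V. single j (h j))) V = h" if "h \<in> V \<rightarrow>\<^sub>E {..N}" for h
      using that by (intro ext) (auto simp: lk PiE_def extensional_def)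
    show "(\<Sum>j\<in>V. single j (restrict (lookup e) V j)) = e" if "e \<in> box V N" for e
      using that by (intro poly_mapping_eqI) (auto simp: lk box_def in_keys_iff)
  qed
  show "finite (box V N)"
    using bij_betw_finite[OF bij] assms by (simp add: finite_PiE)
  show "card (box V N) = (N + 1) ^ card V"
    using bij_betw_same_card[OF bij] assms by (simp add: card_PiE)
qed

lemma box_mono: "N \<le> M \<Longrightarrow> box V N \<subseteq> box V M"
  by (auto simp: box_def intro: order.trans)

lemma keys_mult_box:
  fixes p q :: "'k::field mpoly"
  assumes "keys p \<subseteq> box V N" "keys q \<subseteq> box V M"
  shows "keys (p * q) \<subseteq> box V (N + M)"
proof
  fix e assume "e \<in> keys (p * q)"
  then obtain a b where e: "e = a + b" "a \<in> keys p" "b \<in> keys q" using keys_mult[of p q] by blast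
  hence "a \<in> box V N" "b \<in> box V M" using assms by auto
  thus "e \<in> box V (N + M)"
    unfolding e(1) box_def using keys_add[of a b] by (auto 0 3 simp: lookup_add intro!: add_mono)
qed

lemma keys_power_box:
  fixes p :: "'k::field mpoly"
  assumes "keys p \<subseteq> box V N"
  shows "keys (p ^ k) \<subseteq> box V (k * N)"
proof (induction k)
  case 0
  show ?case by (simp add: box_def)
next
  case (Suc k)
  thus ?case using keys_mult_box[OF assms, of "p ^ k"] by simp
qed

lemma keys_prod_box:
  fixes p :: "'a \<Rightarrow> 'k::field mpoly"
  assumes "finite A" "\<And>j. j \<in> A \<Longrightarrow> keys (p j) \<subseteq> box V (N j)"
  shows "keys (prod p A) \<subseteq> box V (sum N A)"
  using assms
proof (induction A)
  case empty
  show ?case by (simp add: box_def)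
next
  case (insert x A)
  thus ?case using keys_mult_box[of "p x" V "N x" "prod p A" "sum N A"] by simp
qed

lemma polys_box:
  assumes "p \<in> polys V"
  shows "\<exists>N. keys p \<subseteq> box V N"
proof (intro exI subsetI)
  fix e assume e: "e \<in> keys p"
  have "lookup e j \<le> (\<Sum>e\<in>keys p. \<Sum>j\<in>keys e. lookup e j)" for j
  proof (cases "j \<in> keys e")
    case True
    hence "lookup e j \<le> (\<Sum>j\<in>keys e. lookup e j)" by (intro member_le_sum) auto
    also have "\<dots> \<le> (\<Sum>e\<in>keys p. \<Sum>j\<in>keys e. lookup e j)"
      using e by (intro member_le_sum[of e "keys p" "\<lambda>e. \<Sum>j\<in>keys e. lookup e j"]) auto
    finally show ?thesis .
  qed (simp add: in_keys_iff)
  thus "e \<in> box V (\<Sum>e\<in>keys p. \<Sum>j\<in>keys e. lookup e j)"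
    using e assms by (auto simp: box_def in_polys)
qed

lemma uniform_box:
  assumes "finite J" "\<And>j. j \<in> J \<Longrightarrow> f j \<in> polys V"
  shows "\<exists>N. \<forall>j\<in>J. keys (f j) \<subseteq> box V N"
  using assms
proof (induction J)
  case (insert x J)
  then obtain N M where "\<forall>j\<in>J. keys (f j) \<subseteq> box V N" "keys (f x) \<subseteq> box V M"
    using polys_box[of "f x" V] by auto
  thus ?case
    using box_mono[of N "max N M" V] box_mono[of M "max N M" V] by (intro exI[of _ "max N M"]) fastforce
qed simp

text \<open>
  The \<open>(D + 1) ^ card J\<close> products of the \<open>f j\<close> with exponents at most \<open>D\<close> are linearly independent, and
  they lie in the span of the monomials in the variables \<open>V\<close> whose exponents are at most
  \<open>card J * (D * N)\<close>.
\<close>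

lemma alg_indep_card_monomials:
  fixes f :: "nat \<Rightarrow> 'k::field mpoly"
  assumes "finite J" "finite V" "alg_indep J Q f" "0 \<in> Q" "\<And>j. j \<in> J \<Longrightarrow> keys (f j) \<subseteq> box V N"
  shows "(D + 1) ^ card J \<le> (card J * (D * N) + 1) ^ card V"
proof -
  define M where "M = card J * (D * N)"
  define A where "A = monom_eval f ` box J D"
  have fin: "finite (box J D)" "finite (box V M)" using card_box(1) assms(1,2) by auto
  have zero: "F = 0" if "F \<in> polys J" "lext (monom_eval f) F = 0" for F
    using that assms(3,4) by (auto simp: alg_indep_def mpoly_subst_eq_lext)
  have boxJ: "single e c \<in> polys J" if "e \<in> box J D" for e c
    using that by (intro polys_single) (auto simp: box_def)
  have inj: "inj_on (monom_eval f) (box J D)"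
  proof (rule inj_onI)
    fix e e' assume *: "e \<in> box J D" "e' \<in> box J D" "monom_eval f e = monom_eval f e'"
    have "xpow e - xpow e' = (0 :: 'k mpoly)"
      by (rule zero) (use * in \<open>auto intro!: polys_diff boxJ simp: lext_diff\<close>)
    thus "e = e'" by simp
  qed
  have "vs.independent A"
  proof (rule vs.independent_if_scalars_zero)
    show "finite A" using fin by (simp add: A_def)
    fix c x assume s: "(\<Sum>x\<in>A. pscale (c x) x) = 0" and x: "x \<in> A"
    then obtain e0 where e0: "e0 \<in> box J D" "x = monom_eval f e0" by (auto simp: A_def)
    have "(\<Sum>e\<in>box J D. pscale (c (monom_eval f e)) (monom_eval f e)) = 0"
      using s inj by (simp add: A_def sum.reindex)
    hence "lext (monom_eval f) (\<Sum>e\<in>box J D. single e (c (monom_eval f e))) = 0"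
      by (simp only: lext_sum lext_single)
    moreover have "(\<Sum>e\<in>box J D. single e (c (monom_eval f e))) \<in> polys J"
      by (rule vs.subspace_sum[OF subspace_polys]) (rule boxJ)
    ultimately have "(\<Sum>e\<in>box J D. single e (c (monom_eval f e))) = 0"
      by (rule zero[rotated])
    hence "lookup (\<Sum>e\<in>box J D. single e (c (monom_eval f e))) e0 = 0" by simp
    thus "c x = 0" using e0 fin by (simp add: lookup_sum lookup_single when_def)
  qed
  moreover have "A \<subseteq> vs.span (xpow ` box V M)"
  proof (unfold A_def, rule image_subsetI)
    fix e assume e: "e \<in> box J D"
    have "keys (monom_eval f e) \<subseteq> box V (\<Sum>j\<in>keys e. lookup e j * N)"
      unfolding monom_eval_def
      by (intro keys_prod_box keys_power_box assms(5)) (use e in \<open>auto simp: box_def\<close>)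
    also have "(\<Sum>j\<in>keys e. lookup e j * N) \<le> (\<Sum>j\<in>J. lookup e j * N)"
      using e assms(1) by (intro sum_mono2) (auto simp: box_def)
    hence "box V (\<Sum>j\<in>keys e. lookup e j * N) \<subseteq> box V (\<Sum>j\<in>J. lookup e j * N)" by (rule box_mono)
    also have "(\<Sum>j\<in>J. lookup e j * N) \<le> (\<Sum>j\<in>J. D * N)"
      using e by (intro sum_mono mult_right_mono) (auto simp: box_def)
    hence "box V (\<Sum>j\<in>J. lookup e j * N) \<subseteq> box V M" unfolding M_def by (intro box_mono) simp
    finally have "lext xpow (monom_eval f e) \<in> vs.span (xpow ` box V M)"
      by (intro lext_mem_subspace vs.span_base) auto
    thus "monom_eval f e \<in> vs.span (xpow ` box V M)" by simp
  qed
  ultimately have "card A \<le> card (xpow ` box V M :: 'k mpoly set)"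
    using vs.independent_span_bound[of "xpow ` box V M" A] fin by simp
  also have "\<dots> \<le> card (box V M)" using fin by (intro card_image_le)
  finally show ?thesis
    using card_box(2)[OF assms(1)] card_box(2)[OF assms(2)] card_image[OF inj]
    by (simp add: A_def M_def)
qed

text \<open>
  As functions of \<open>D\<close>, the two sides of the previous estimate grow with orders \<open>card J\<close> and \<open>card V\<close>.
\<close>

lemma alg_indep_card_le:
  assumes "finite J" "finite V" "alg_indep J Q f" "0 \<in> Q" "\<And>j. j \<in> J \<Longrightarrow> f j \<in> polys V"
  shows "card J \<le> card V"
proof (rule ccontr)
  assume "\<not> card J \<le> card V"
  hence lt: "Suc (card V) \<le> card J" by simp
  obtain N where N: "\<forall>j\<in>J. keys (f j) \<subseteq> box V N" using uniform_box[of J f V] assms by blast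
  \<comment> \<open>With \<open>card J * (D * N) + 1 \<le> B * (D + 1)\<close> the estimate gives \<open>D + 1 \<le> B ^ card V\<close>, which fails for this \<open>D\<close>.\<close>
  define B where "B = card J * N + 1"
  define D where "D = B ^ card V"
  have "(D + 1) * (D + 1) ^ card V \<le> (D + 1) ^ card J"
    using power_increasing[OF lt, of "D + 1"] by simp
  also have "\<dots> \<le> (card J * (D * N) + 1) ^ card V"
    by (rule alg_indep_card_monomials[OF assms(1-4)]) (use N in auto)
  also have "\<dots> \<le> (B * (D + 1)) ^ card V"
    by (rule power_mono) (auto simp: B_def algebra_simps)
  also have "\<dots> = D * (D + 1) ^ card V" by (simp only: D_def power_mult_distrib)
  finally show False by simp
qed

section \<open>The height of a toric ideal\<close>

lemma keys_relspace: "relspace a V \<subseteq> {u. keys u \<subseteq> V}"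
  by (auto simp: relspace_def)

lemma relspace_pivots:
  assumes "finite V"
  obtains js where "distinct js" "set js \<subseteq> V" "length js = vs.dim (relspace a V)"
    "\<forall>i<length js. \<exists>u\<in>relspace a V. (\<forall>j\<in>set (take i js). lookup u j = 0) \<and> lookup u (js ! i) \<noteq> 0"
    "\<forall>u\<in>relspace a V. (\<forall>j\<in>set js. lookup u j = 0) \<longrightarrow> u = 0"
  using pivot_coordinates[OF assms subspace_relspace[of a V] keys_relspace]
proof (elim exE conjE)
  fix js :: "nat list" and B
  assume B: "vs.independent B" "card B = length js" "B \<subseteq> relspace a V" "relspace a V \<subseteq> vs.span B"
  have dim: "length js = vs.dim (relspace a V)"
    using vs.basis_card_eq_dim[OF B(3,4,1)] B(2) by simp
  assume "distinct js" "set js \<subseteq> V"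
    "\<forall>i<length js. \<exists>u\<in>relspace a V. (\<forall>j\<in>set (take i js). lookup u j = 0) \<and> lookup u (js ! i) \<noteq> 0"
    "\<forall>u\<in>relspace a V. (\<forall>j\<in>set js. lookup u j = 0) \<longrightarrow> u = 0"
  thus thesis by (intro that[OF _ _ dim])
qed

text \<open>
  The variables outside the pivots are independent modulo the toric ideal: two exponents in these
  variables with equal images differ by a relation that vanishes at all pivots, hence by zero.
  Along a chain of length \<open>l\<close> this independent family grows by \<open>l\<close> elements.
\<close>

lemma prime_height_toric_le:
  fixes a :: "nat \<Rightarrow> (nat \<Rightarrow>\<^sub>0 nat)"
  assumes V: "finite V"
  shows "prime_height (mpoly_ring V) (toric a V :: 'k::field mpoly set) \<le> enat (vs.dim (relspace a V))"
proof -
  obtain js where js: "distinct js" "set js \<subseteq> V" "length js = vs.dim (relspace a V)"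
    "\<forall>i<length js. \<exists>u\<in>relspace a V. (\<forall>j\<in>set (take i js). lookup u j = 0) \<and> lookup u (js ! i) \<noteq> 0"
    "\<forall>u\<in>relspace a V. (\<forall>j\<in>set js. lookup u j = 0) \<longrightarrow> u = 0"
    by (rule relspace_pivots[OF V, where a = a])
  have indep: "alg_indep (V - set js) (toric a V :: 'k mpoly set) mvar"
    unfolding alg_indep_def mpoly_subst_mvar
  proof (intro ballI impI)
    fix F :: "'k mpoly" assume F: "F \<in> polys (V - set js)" "F \<in> toric a V"
    have "push (\<lambda>e. e) F = 0"
    proof (rule push_factor[of F "lext a"])
      show "push (lext a) F = 0" using F(2) by (simp add: toric_def push_ker_def)
      fix e e' assume *: "e \<in> keys F" "e' \<in> keys F" "lext a e = lext a e'"
      have e: "keys e \<subseteq> V - set js" "keys e' \<subseteq> V - set js" using F(1) *(1,2) unfolding in_polys by blast+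
      hence eV: "keys e \<subseteq> V" "keys e' \<subseteq> V" by blast+
      have "expdiff (e, e') = 0"
      proof -
        have "expdiff (e, e') \<in> relspace a V" using expdiff_in_relspace[OF eV, of a] *(3) by blast
        moreover have "\<forall>j\<in>set js. lookup (expdiff (e, e')) j = 0"
        proof
          fix j assume "j \<in> set js"
          hence "lookup e j = 0" "lookup e' j = 0" using e by (auto intro: lookup_eq_0)
          thus "lookup (expdiff (e, e')) j = 0" by (simp add: expdiff_def lookup_minus)
        qed
        ultimately show ?thesis using js(5) by blast
      qed
      thus "e = e'" by (simp add: expdiff_def)
    qed
    thus "F = 0" by (simp add: push_def)
  qed
  show ?thesis
    unfolding prime_height_def
  proof (rule SUP_least)
    fix l assume "l \<in> {l. \<exists>Q. (\<forall>i\<le>l. primeideal (Q i) (mpoly_ring V)) \<and> (\<forall>i<l. Q i \<subset> Q (Suc i)) \<and>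
      Q l = (toric a V :: 'k mpoly set)}"
    then obtain Q where Q: "\<And>i. i \<le> l \<Longrightarrow> primeideal (Q i) (mpoly_ring V)"
      "\<And>i. i < l \<Longrightarrow> Q i \<subset> Q (Suc i)" "Q l = (toric a V :: 'k mpoly set)" by blast
    have "(mvar j :: 'k mpoly) \<in> polys V" if "j \<in> V - set js" for j
      using that by (simp add: mvar_def in_polys)
    then obtain J' f' where J': "finite J'" "card J' = card (V - set js) + l"
      "alg_indep J' (Q 0) f'" "\<forall>j\<in>J'. f' j \<in> polys V"
      using alg_indep_chain[of l Q V "V - set js" mvar l] Q indep V by auto
    have "0 \<in> Q 0" using Q(1)[of 0] ideal_mpolyD(2) primeideal.axioms(1) by blast
    hence "card J' \<le> card V" using alg_indep_card_le[OF J'(1) V J'(3)] J'(4) by blast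
    moreover have "card (set js) \<le> card V" using js(2) V by (rule card_mono[rotated])
    moreover have "card (V - set js) = card V - card (set js)"
      using js(2) by (simp add: card_Diff_subset)
    ultimately have "l \<le> card (set js)" using J'(2) by linarith
    thus "enat l \<le> enat (vs.dim (relspace a V))" using js(1,3) distinct_card by fastforce
  qed
qed

text \<open>
  For \<open>j \<in> K\<close> the exponent vector is extended by a new coordinate \<open>m + j\<close>. If \<open>m\<close> bounds the old
  coordinates, the relations of the extended family are those relations of \<open>a\<close> that vanish on \<open>K\<close>,
  and its toric ideal is again prime.
\<close>

definition tagged :: "nat \<Rightarrow> nat set \<Rightarrow> (nat \<Rightarrow> (nat \<Rightarrow>\<^sub>0 nat)) \<Rightarrow> nat \<Rightarrow> (nat \<Rightarrow>\<^sub>0 nat)" where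
  "tagged m K a j = a j + (if j \<in> K then single (m + j) 1 else 0)"

lemma tagged_eq_iff:
  assumes m: "\<forall>j\<in>V. keys (a j) \<subseteq> {..<m}" and e: "keys e \<subseteq> V" "keys e' \<subseteq> V"
  shows "lext (tagged m K a) e = lext (tagged m K a) e' \<longleftrightarrow>
           lext a e = lext a e' \<and> (\<forall>j\<in>K. lookup e j = lookup e' j)"
proof -
  define t where "t j = (if j \<in> K then single (m + j) (1::nat) else 0)" for j
  have split: "lext (tagged m K a) x = lext a x + lext t x" for x
    using lext_fun_add[of a t x] by (simp add: tagged_def[abs_def] t_def)
  have low: "lookup (lext t x) i = 0" if "i < m" for x i
    using that by (auto simp: lookup_lext t_def lookup_single when_def)
  have high: "lookup (lext t x) (m + i) = (if i \<in> K then lookup x i else 0)" for x i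
  proof -
    have "lookup (lext t x) (m + i) = (\<Sum>j\<in>keys x. if i = j then (if i \<in> K then lookup x i else 0) else 0)"
      unfolding lookup_lext by (rule sum.cong) (auto simp: t_def lookup_single when_def)
    thus ?thesis by (simp add: in_keys_iff)
  qed
  have zero: "lookup (lext a x) (m + i) = 0" if "keys x \<subseteq> V" for x i
  proof -
    have "keys (lext a x) \<subseteq> {..<m}" using keys_lext[of a x] m that by blast
    thus ?thesis by (intro lookup_eq_0) auto
  qed
  show ?thesis (is "?L \<longleftrightarrow> ?R")
  proof
    assume ?L
    hence eq: "lookup (lext a e) i + lookup (lext t e) i = lookup (lext a e') i + lookup (lext t e') i" for i
      by (metis lookup_add split)
    have "lookup e j = lookup e' j" if "j \<in> K" for j
      using eq[of "m + j"] that by (simp add: high zero e)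
    moreover have "lookup (lext a e) i = lookup (lext a e') i" for i
    proof (cases "i < m")
      case False
      then obtain k where "i = m + k" using le_Suc_ex not_less by blast
      thus ?thesis by (simp add: zero e)
    qed (use eq[of i] low in simp)
    ultimately show ?R by (simp add: poly_mapping_eqI)
  next
    assume R: ?R
    have "lookup (lext t e) i = lookup (lext t e') i" for i
    proof (cases "i < m")
      case False
      then obtain k where "i = m + k" using le_Suc_ex not_less by blast
      thus ?thesis using R by (simp add: high)
    qed (simp add: low)
    hence "lext t e = lext t e'" by (rule poly_mapping_eqI)
    thus ?L using R by (simp add: split)
  qed
qed

text \<open>
  Releasing the tags of the pivots one at a time, starting with the last, enlarges the ideal: a relation
  that vanishes at the earlier pivots but not at the released one yields a binomial that was not
  there before.
\<close>

lemma toric_tagged_chain: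
  fixes a :: "nat \<Rightarrow> (nat \<Rightarrow>\<^sub>0 nat)"
  assumes V: "finite V"
  obtains Q :: "nat \<Rightarrow> 'k::field mpoly set" where
    "\<And>i. primeideal (Q i) (mpoly_ring V)" "\<And>i. i < vs.dim (relspace a V) \<Longrightarrow> Q i \<subset> Q (Suc i)"
    "Q (vs.dim (relspace a V)) = toric a V"
proof -
  define r where "r = vs.dim (relspace a V)"
  obtain js where js: "distinct js" "set js \<subseteq> V" "length js = vs.dim (relspace a V)"
    "\<forall>i<length js. \<exists>u\<in>relspace a V. (\<forall>j\<in>set (take i js). lookup u j = 0) \<and> lookup u (js ! i) \<noteq> 0"
    "\<forall>u\<in>relspace a V. (\<forall>j\<in>set js. lookup u j = 0) \<longrightarrow> u = 0"
    by (rule relspace_pivots[OF V, where a = a])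
  have "finite (\<Union>j\<in>V. keys (a j))" using V by simp
  then obtain m where "\<forall>i\<in>(\<Union>j\<in>V. keys (a j)). i < m"
    unfolding finite_nat_set_iff_bounded by (elim exE)
  hence m: "\<forall>j\<in>V. keys (a j) \<subseteq> {..<m}" by auto
  define K where "K i = set (take (r - i) js)" for i
  define Q :: "nat \<Rightarrow> 'k mpoly set" where "Q i = toric (tagged m (K i) a) V" for i
  note eq = tagged_eq_iff[OF m]
  show ?thesis
  proof (rule that)
    show "primeideal (Q i) (mpoly_ring V)" for i unfolding Q_def by (rule primeideal_toric)
    have "tagged m (K r) a = a" by (rule ext) (simp add: tagged_def K_def)
    thus "Q (vs.dim (relspace a V)) = toric a V" by (simp only: Q_def flip: r_def)
    fix i assume i: "i < vs.dim (relspace a V)"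
    hence *: "r - i = Suc (r - Suc i)" "r - Suc i < length js" using js(3) by (simp_all add: r_def)
    have K: "K i = insert (js ! (r - Suc i)) (K (Suc i))"
      using take_Suc_conv_app_nth[OF *(2)] by (simp only: K_def *(1)) simp
    show "Q i \<subset> Q (Suc i)"
    proof (rule psubsetI)
      show "Q i \<subseteq> Q (Suc i)"
      proof
        fix p assume p: "p \<in> Q i"
        hence pV: "p \<in> polys V" "push (lext (tagged m (K i) a)) p = 0"
          by (simp_all add: Q_def toric_def push_ker_def)
        have "push (lext (tagged m (K (Suc i)) a)) p = 0"
        proof (rule push_factor[OF _ pV(2)])
          fix e e' assume e: "e \<in> keys p" "e' \<in> keys p"
            "lext (tagged m (K i) a) e = lext (tagged m (K i) a) e'"
          have "keys e \<subseteq> V" "keys e' \<subseteq> V" using e pV(1) by (simp_all add: in_polys)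
          thus "lext (tagged m (K (Suc i)) a) e = lext (tagged m (K (Suc i)) a) e'"
            using e(3) eq[of e e'] K by simp
        qed
        thus "p \<in> Q (Suc i)" using pV(1) by (simp add: Q_def toric_def push_ker_def)
      qed
      obtain u where u: "u \<in> relspace a V" "\<forall>j\<in>K (Suc i). lookup u j = 0" "lookup u (js ! (r - Suc i)) \<noteq> 0"
        using js(4)[rule_format, OF *(2)] unfolding K_def by blast
      obtain N :: nat and z where z: "N > 0" "z \<in> rel_pairs a V" "expdiff z = pscale (of_nat N) u"
        using u(1) by (rule clear_denominators)
      obtain x y where xy: "z = (x, y)" by (cases z)
      have V: "keys x \<subseteq> V" "keys y \<subseteq> V" "lext a x = lext a y" using z(2) by (auto simp: xy rel_pairs_def)
      have xyu: "rat_of_nat (lookup x j) - of_nat (lookup y j) = of_nat N * lookup u j" for j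
        using arg_cong[OF z(3), of "\<lambda>p. lookup p j"] by (simp add: xy expdiff_def lookup_minus)
      have iff: "lookup x j = lookup y j \<longleftrightarrow> lookup u j = 0" for j
      proof -
        have "lookup x j = lookup y j \<longleftrightarrow> rat_of_nat (lookup x j) - of_nat (lookup y j) = 0" by simp
        also have "\<dots> \<longleftrightarrow> lookup u j = 0" using z(1) by (simp only: xyu) simp
        finally show ?thesis .
      qed
      have "(xbinom (x, y) :: 'k mpoly) \<in> Q (Suc i)"
        unfolding Q_def using V u(2) by (simp add: xbinom_in_toric eq iff)
      moreover have "(xbinom (x, y) :: 'k mpoly) \<notin> Q i"
        unfolding Q_def using V u(3) by (simp add: xbinom_in_toric eq iff K)
      ultimately show "Q i \<noteq> Q (Suc i)" by blast
    qed
  qed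
qed

text \<open>
  The height of an ideal is an infimum over all primes above it. Such a prime \<open>P\<close> still lies at the top
  of a chain of length \<open>r\<close>: replace the last member of the chain below the toric ideal by \<open>P\<close>.
\<close>

theorem height_toric:
  assumes V: "finite V"
  shows "height (mpoly_ring V) (toric a V :: 'k::field mpoly set) = enat (vs.dim (relspace a V))"
proof (rule antisym)
  have "height (mpoly_ring V) (toric a V :: 'k mpoly set) \<le>
    prime_height (mpoly_ring V) (toric a V :: 'k mpoly set)"
    unfolding height_def by (rule INF_lower) (simp add: primeideal_toric)
  thus "height (mpoly_ring V) (toric a V :: 'k mpoly set) \<le> enat (vs.dim (relspace a V))"
    using prime_height_toric_le[OF V, of a] by (rule order.trans)
  let ?r = "vs.dim (relspace a V)"
  obtain Q :: "nat \<Rightarrow> 'k mpoly set" where Q: "\<And>i. primeideal (Q i) (mpoly_ring V)"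
    "\<And>i. i < ?r \<Longrightarrow> Q i \<subset> Q (Suc i)" "Q ?r = toric a V"
    using toric_tagged_chain[OF V, of a] by metis
  show "enat ?r \<le> height (mpoly_ring V) (toric a V :: 'k mpoly set)"
    unfolding height_def
  proof (rule INF_greatest)
    fix P :: "'k mpoly set" assume P: "P \<in> {P. primeideal P (mpoly_ring V) \<and> toric a V \<subseteq> P}"
    define Q' where "Q' i = (if i < ?r then Q i else P)" for i
    have "Q' i \<subset> Q' (Suc i)" if "i < ?r" for i
      using Q(2)[OF that] Q(3) P that unfolding Q'_def by (cases "Suc i < ?r") (auto simp: not_less_eq less_Suc_eq)
    moreover have "primeideal (Q' i) (mpoly_ring V)" for i using Q(1) P by (simp add: Q'_def)
    moreover have "Q' ?r = P" by (simp add: Q'_def)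
    ultimately show "enat ?r \<le> prime_height (mpoly_ring V) P"
      unfolding prime_height_def by (intro SUP_upper) blast
  qed
qed

section \<open>Generators of a toric ideal\<close>

text \<open>
  The part of a polynomial supported on the exponents in \<open>E\<close>. Two cases matter: homogeneous
  components, and setting some of the variables to zero.
\<close>

definition restr :: "(nat \<Rightarrow>\<^sub>0 nat) set \<Rightarrow> 'k::field mpoly \<Rightarrow> 'k mpoly" where
  "restr E = lext (\<lambda>e. if e \<in> E then xpow e else 0)"

lemma lookup_restr: "lookup (restr E p) e = (if e \<in> E then lookup p e else 0)"
proof -
  have "lookup (restr E p) e = (\<Sum>e'\<in>keys p. if e = e' then (if e \<in> E then lookup p e else 0) else 0)"
    unfolding restr_def lookup_lext by (rule sum.cong) (auto simp: lookup_single when_def)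
  thus ?thesis by (simp add: in_keys_iff)
qed

lemma restr_simps [simp]: "restr E 0 = 0" "restr {} p = 0"
  by (rule poly_mapping_eqI, simp add: lookup_restr)+

lemma restr_add: "restr E (p + q) = restr E p + restr E q"
  and restr_pscale: "restr E (pscale c p) = pscale c (restr E p)"
  by (rule poly_mapping_eqI, simp add: lookup_restr lookup_add)+

lemma lookup_single_mult:
  fixes p :: "'k::field mpoly"
  shows "single u c * p = lext (\<lambda>e. single (u + e) c) p"
proof -
  have "single u c * lext xpow p = lext (\<lambda>e. single (u + e) c) p"
    by (simp add: mult_lext mult_single del: lext_ident)
  thus ?thesis by (simp only: lext_ident)
qed

lemma restr_single_mult: "restr E (single u c * p) = single u c * restr {e. u + e \<in> E} p"
proof -
  have "restr E (single u c * p) = lext (\<lambda>e. lext (\<lambda>e. if e \<in> E then xpow e else 0) (single (u + e) c)) p"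
    by (simp add: lookup_single_mult restr_def lext_lext)
  also have "\<dots> = lext (\<lambda>e. single u c * (if e \<in> {e. u + e \<in> E} then xpow e else 0)) p"
    by (rule lext_cong) (simp add: mult_single)
  also have "\<dots> = single u c * restr {e. u + e \<in> E} p" by (simp add: restr_def mult_lext)
  finally show ?thesis .
qed

lemma restr_xbinom:
  assumes "u \<in> E \<longleftrightarrow> v \<in> E"
  shows "restr E (xbinom (u, v)) = (if u \<in> E then xbinom (u, v) else 0)"
  by (rule poly_mapping_eqI) (use assms in \<open>auto simp: lookup_restr xbinom_def lookup_minus lookup_single when_def\<close>)

lemma restr_span:
  assumes "p \<in> vs.span B" "vs.subspace S" "\<And>b. b \<in> B \<Longrightarrow> restr E b \<in> S"
  shows "restr E p \<in> S"
  using assms(1)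
proof (induction rule: vs.span_induct)
  case base
  show ?case
    using assms(2) by (auto simp: vs.subspace_def restr_add restr_pscale)
qed (rule assms(3))

text \<open>
  The degree of the monomial that \<open>x\<^sup>e\<close> is mapped to.
\<close>

definition weight :: "(nat \<Rightarrow> (nat \<Rightarrow>\<^sub>0 nat)) \<Rightarrow> (nat \<Rightarrow>\<^sub>0 nat) \<Rightarrow> nat" where
  "weight a e = (\<Sum>i\<in>keys (lext a e). lookup (lext a e) i)"

lemma sum_lookup_add:
  fixes b c :: "nat \<Rightarrow>\<^sub>0 nat"
  shows "(\<Sum>i\<in>keys (b + c). lookup (b + c) i) = (\<Sum>i\<in>keys b. lookup b i) + (\<Sum>i\<in>keys c. lookup c i)"
proof -
  have sup: "(\<Sum>i\<in>keys d. lookup d i) = (\<Sum>i\<in>keys b \<union> keys c. lookup d i)"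
    if "keys d \<subseteq> keys b \<union> keys c" for d :: "nat \<Rightarrow>\<^sub>0 nat"
    by (rule sum.mono_neutral_left) (use that in \<open>auto simp: in_keys_iff\<close>)
  show ?thesis
    using sup[OF keys_add] sup[of b] sup[of c] by (simp add: lookup_add sum.distrib)
qed

lemma weight_add: "weight a (e + e') = weight a e + weight a e'"
  by (simp add: weight_def lext_add sum_lookup_add)

lemma weight_unit_pos: "a j \<noteq> 0 \<Longrightarrow> weight a (single j 1) > 0"
proof -
  assume "a j \<noteq> 0"
  hence "keys (a j) \<noteq> {}" by (rule contrapos_nn) (rule keys_empty_imp_0)
  hence "(\<Sum>i\<in>keys (a j). lookup (a j) i) > 0"
    by (intro sum_pos) (simp_all add: in_keys_iff)
  thus ?thesis by (simp only: weight_def lext_single pscale_1)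
qed

text \<open>
  The linear span of this set is the product of \<open>I\<close> with the irrelevant ideal.
\<close>

definition var_multiples :: "nat set \<Rightarrow> 'k::field mpoly set \<Rightarrow> 'k mpoly set" where
  "var_multiples V I = {mvar j * p | j p. j \<in> V \<and> p \<in> I}"

text \<open>
  By induction on \<open>d\<close>, the component of weight \<open>d\<close> of every element of the toric ideal lies in the ideal
  generated by \<open>C\<close>. Write the element as a combination of multiples \<open>x\<^sub>j * p'\<close> and of members of \<open>C\<close>.
  The members of \<open>C\<close> are homogeneous. The component of weight \<open>d\<close> of \<open>x\<^sub>j * p'\<close> is \<open>x\<^sub>j\<close> times a component
  of \<open>p'\<close> of smaller weight, as \<open>x\<^sub>j\<close> has positive weight.
\<close>

lemma graded_nakayama:
  fixes C :: "'k::field mpoly set"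
  assumes nz: "\<forall>j\<in>V. a j \<noteq> 0" and C: "C \<subseteq> xbinom ` rel_pairs a V"
    and span: "toric a V \<subseteq> vs.span (var_multiples V (toric a V) \<union> C)"
  shows "genideal (mpoly_ring V) C = toric a V"
proof
  have CT: "C \<subseteq> toric a V" using C xbinom_rel_pairs by blast
  hence CV: "C \<subseteq> polys V" using toric_subset_polys by blast
  note G = genideal_mpoly[OF CV]
  let ?G = "genideal (mpoly_ring V) C"
  show "?G \<subseteq> toric a V" by (rule G(3)[OF ideal_toric CT])
  define H :: "nat \<Rightarrow> 'k mpoly \<Rightarrow> 'k mpoly" where "H d = restr {e. weight a e = d}" for d
  have *: "\<forall>p\<in>toric a V. H d p \<in> ?G" for d
  proof (induction d rule: less_induct)
    case (less d)
    show ?case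
    proof
      fix p :: "'k mpoly" assume "p \<in> toric a V"
      hence "p \<in> vs.span (var_multiples V (toric a V) \<union> C)" using span by blast
      thus "H d p \<in> ?G"
        unfolding H_def
      proof (rule restr_span[OF _ subspace_ideal[OF G(1)]])
        fix q assume "q \<in> var_multiples V (toric a V) \<union> C"
        thus "restr {e. weight a e = d} q \<in> ?G"
        proof
          assume "q \<in> C"
          moreover obtain u v where q: "q = xbinom (u, v)" "(u, v) \<in> rel_pairs a V"
            using \<open>q \<in> C\<close> C by auto
          moreover have "weight a u = weight a v" using q(2) by (simp add: weight_def rel_pairs_def)
          ultimately show ?thesis
            using G(2) unfolding q(1) by (subst restr_xbinom) (auto simp: ideal_mpolyD(2)[OF G(1)])
        next
          assume "q \<in> var_multiples V (toric a V)"
          then obtain j p' where q: "q = mvar j * p'" "j \<in> V" "p' \<in> toric a V"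
            by (auto simp: var_multiples_def)
          define w where "w = weight a (single j 1)"
          have w: "w > 0" unfolding w_def by (rule weight_unit_pos) (use nz q(2) in blast)
          have eq: "restr {e. weight a e = d} q = mvar j * restr {e. w + weight a e = d} p'"
            by (simp add: q(1) mvar_def restr_single_mult weight_add w_def)
          show ?thesis
          proof (cases "w \<le> d")
            case True
            hence "{e. w + weight a e = d} = {e. weight a e = d - w}" by auto
            hence "restr {e. weight a e = d} q = mvar j * H (d - w) p'" by (simp add: eq H_def)
            moreover have "H (d - w) p' \<in> ?G" using less.IH[of "d - w"] w True q(3) by auto
            moreover have "mvar j \<in> polys V" using q(2) by (simp add: mvar_def in_polys)
            ultimately show ?thesis using ideal_mpolyD(4)[OF G(1)] by metis
          next
            case False
            hence "{e. w + weight a e = d} = {}" by auto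
            thus ?thesis by (simp add: eq ideal_mpolyD(2)[OF G(1)])
          qed
        qed
      qed
    qed
  qed
  show "toric a V \<subseteq> ?G"
  proof
    fix p :: "'k mpoly" assume p: "p \<in> toric a V"
    have "p = (\<Sum>d\<in>weight a ` keys p. H d p)"
    proof (rule poly_mapping_eqI)
      fix e
      have "lookup (\<Sum>d\<in>weight a ` keys p. H d p) e =
        (\<Sum>d\<in>weight a ` keys p. if weight a e = d then lookup p e else 0)"
        by (simp add: lookup_sum H_def lookup_restr)
      also have "\<dots> = lookup p e" by (auto simp: in_keys_iff)
      finally show "lookup p e = lookup (\<Sum>d\<in>weight a ` keys p. H d p) e" by simp
    qed
    moreover have "(\<Sum>d\<in>weight a ` keys p. H d p) \<in> ?G"
      by (rule vs.subspace_sum[OF subspace_ideal[OF G(1)]]) (use * p in blast)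
    ultimately show "p \<in> ?G" by simp
  qed
qed

text \<open>
  The span on the right is itself an ideal: a monomial multiple of an element of the toric ideal is
  a scalar multiple of it or contains a variable, and then it belongs to \<open>var_multiples\<close>.
\<close>

lemma generators_span_mod_var_multiples:
  fixes S :: "'k::field mpoly set"
  assumes S: "S \<subseteq> polys V" and gen: "genideal (mpoly_ring V) S = toric a V"
  shows "toric a V \<subseteq> vs.span (var_multiples V (toric a V) \<union> S)"
proof -
  define M :: "'k mpoly set" where "M = var_multiples V (toric a V)"
  have ST: "S \<subseteq> toric a V" using genideal_mpoly(2)[OF S] gen by simp
  have MT: "M \<subseteq> toric a V"
    unfolding M_def var_multiples_def by (auto intro!: ideal_mpolyD(4)[OF ideal_toric] simp: mvar_def in_polys)
  have "ideal (vs.span (M \<union> S)) (mpoly_ring V)"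
  proof (rule ideal_mpolyI)
    have "M \<union> S \<subseteq> polys V" using MT S toric_subset_polys by blast
    thus "vs.span (M \<union> S) \<subseteq> polys V" by (rule vs.span_minimal[OF _ subspace_polys])
    fix p :: "'k mpoly" and e :: "nat \<Rightarrow>\<^sub>0 nat" and c :: 'k
    assume p: "p \<in> vs.span (M \<union> S)" and e: "keys e \<subseteq> V"
    show "single e c * p \<in> vs.span (M \<union> S)"
      using p
    proof (induction rule: vs.span_induct)
      case base
      show ?case
        by (rule vs.subspaceI) (auto simp: distrib_left mult_pscale intro: vs.span_add vs.span_scale vs.span_zero)
    next
      case (step p)
      hence pT: "p \<in> toric a V" using MT ST by blast
      show ?case
      proof (cases "e = 0")
        case True
        thus ?thesis using step by (simp add: vs.span_base vs.span_scale flip: pscale_eq_mult)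
      next
        case False
        hence "keys e \<noteq> {}" by (rule contrapos_nn) (rule keys_empty_imp_0)
        then obtain j where j: "j \<in> keys e" by blast
        have "single j 1 + (e - single j 1) = e"
          by (rule poly_mapping_eqI) (use j in \<open>auto simp: in_keys_iff lookup_add lookup_minus lookup_single when_def\<close>)
        hence "single e c * p = mvar j * (single (e - single j 1) c * p)"
          by (simp add: mvar_def mult_single flip: mult.assoc)
        moreover have "single (e - single j 1) c * p \<in> toric a V"
        proof (rule ideal_mpolyD(4)[OF ideal_toric pT polys_single])
          show "keys (e - single j 1) \<subseteq> V" using e by (auto simp: in_keys_iff lookup_minus)
        qed
        ultimately have "single e c * p \<in> M" unfolding M_def var_multiples_def using j e by blast
        thus ?thesis by (simp add: vs.span_base)
      qed
    qed
  qed (auto intro: vs.span_zero vs.span_add)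
  moreover have "S \<subseteq> vs.span (M \<union> S)" by (simp add: vs.span_base subset_iff)
  ultimately have "genideal (mpoly_ring V) S \<subseteq> vs.span (M \<union> S)"
    by (rule genideal_mpoly(3)[OF S])
  thus ?thesis by (simp only: gen M_def)
qed

text \<open>
  Modulo the product with the irrelevant ideal, the toric ideal is a vector space that is spanned by
  the given generators, and also by binomials. A basis chosen among the binomials has at most
  \<open>card S\<close> elements, and it generates the ideal by Nakayama.
\<close>

lemma binomial_generators:
  fixes S :: "'k::field mpoly set"
  assumes nz: "\<forall>j\<in>V. a j \<noteq> 0"
    and S: "finite S" "S \<subseteq> polys V" "genideal (mpoly_ring V) S = toric a V"
  obtains D where "finite D" "D \<subseteq> rel_pairs a V" "card D \<le> card S"
    "genideal (mpoly_ring V) (xbinom ` D) = (toric a V :: 'k mpoly set)"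
proof -
  define M :: "'k mpoly set" where "M = var_multiples V (toric a V)"
  define Bin :: "'k mpoly set" where "Bin = xbinom ` rel_pairs a V"
  have TBin: "toric a V = vs.span Bin" unfolding Bin_def by (rule toric_eq_span_binomials)
  have TS: "toric a V \<subseteq> vs.span (M \<union> S)"
    unfolding M_def by (rule generators_span_mod_var_multiples[OF S(2,3)])
  obtain B0 where B0: "B0 \<subseteq> M" "vs.independent B0" "M \<subseteq> vs.span B0"
    using vs.maximal_independent_subset[of M] by metis
  obtain B where B: "B0 \<subseteq> B" "B \<subseteq> B0 \<union> Bin" "vs.independent B" "B0 \<union> Bin \<subseteq> vs.span B"
    using vs.maximal_independent_subset_extend[of B0 "B0 \<union> Bin"] B0(2) by auto
  define C where "C = B - B0"
  have CBin: "C \<subseteq> Bin" using B(2) by (auto simp: C_def)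
  \<comment> \<open>\<open>g\<close> plays the part of the quotient map: it kills the product with the irrelevant ideal and fixes \<open>C\<close>.\<close>
  obtain g where g: "Vector_Spaces.linear pscale pscale g" "\<And>b. b \<in> B \<Longrightarrow> g b = (if b \<in> B0 then 0 else b)"
    using vsp.linear_independent_extend[OF B(3), of "\<lambda>b. if b \<in> B0 then 0 else b"] by blast
  have g_span: "vs.span (g ` Y) = g ` vs.span Y" for Y
    by (rule module_hom.span_image[OF Vector_Spaces.linear.axioms(3)[OF g(1)]])
  have "C \<subseteq> vs.span (g ` S)"
  proof
    fix c assume c: "c \<in> C"
    have "c \<in> toric a V" using c CBin TBin vs.span_base by blast
    hence "c \<in> vs.span (B0 \<union> S)"
    proof -
      have "M \<union> S \<subseteq> vs.span (B0 \<union> S)"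
        using B0(3) vs.span_mono[of B0 "B0 \<union> S"] vs.span_superset[of "B0 \<union> S"] by blast
      hence "vs.span (M \<union> S) \<subseteq> vs.span (B0 \<union> S)" by (simp add: vs.span_minimal)
      thus ?thesis using TS \<open>c \<in> toric a V\<close> by blast
    qed
    hence "g c \<in> vs.span (g ` (B0 \<union> S))" unfolding g_span by (rule imageI)
    also have "g ` (B0 \<union> S) \<subseteq> vs.span (g ` S)"
      using g(2) B(1) by (auto simp: vs.span_zero vs.span_base)
    hence "vs.span (g ` (B0 \<union> S)) \<subseteq> vs.span (g ` S)" by (simp add: vs.span_minimal)
    finally show "c \<in> vs.span (g ` S)" using g(2)[of c] c by (simp add: C_def)
  qed
  moreover have "vs.independent C" using vs.independent_mono[OF B(3)] by (auto simp: C_def)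
  ultimately have C: "finite C" "card C \<le> card (g ` S)"
    using vs.independent_span_bound[of "g ` S" C] S(1) by auto
  have "toric a V \<subseteq> vs.span (M \<union> C)"
  proof -
    have "B \<subseteq> M \<union> C" using B0(1) by (auto simp: C_def)
    hence "Bin \<subseteq> vs.span (M \<union> C)" using B(4) vs.span_mono[of B "M \<union> C"] by blast
    thus ?thesis unfolding TBin by (simp add: vs.span_minimal)
  qed
  hence gen: "genideal (mpoly_ring V) C = toric a V"
    using graded_nakayama[OF nz CBin[unfolded Bin_def]] unfolding M_def by blast
  obtain D where D: "D \<subseteq> rel_pairs a V" "inj_on (xbinom :: _ \<Rightarrow> 'k mpoly) D" "C = xbinom ` D"
    using CBin unfolding Bin_def subset_image_inj by blast
  show ?thesis
  proof (rule that[OF _ D(1)])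
    show "finite D" using C(1) D(2,3) by (simp add: finite_image_iff)
    show "card D \<le> card S"
      using card_image[OF D(2)] C(2) card_image_le[OF S(1), of g] D(3) by simp
    show "genideal (mpoly_ring V) (xbinom ` D) = (toric a V :: 'k mpoly set)" using gen D(3) by simp
  qed
qed

text \<open>
  Let \<open>M\<close> be the span of the exponent differences of the generators. The polynomials whose coefficients
  sum to zero over every class of exponents modulo \<open>M\<close> form an ideal, which contains the generators and
  hence every binomial of the toric ideal. A binomial with this property has both exponents in
  the same class.
\<close>

lemma binomial_generators_span_relspace:
  assumes D: "D \<subseteq> rel_pairs a V" and gen: "genideal (mpoly_ring V) (xbinom ` D) = (toric a V :: 'k::field mpoly set)"
  shows "relspace a V \<subseteq> vs.span (expdiff ` D)"
proof -
  define M where "M = vs.span (expdiff ` D)"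
  have M: "vs.subspace M" by (simp add: M_def)
  \<comment> \<open>\<open>\<kappa>\<close> chooses a representative of the class modulo \<open>M\<close>, so that \<open>push \<kappa>\<close> sums coefficients over classes.\<close>
  define \<kappa> where "\<kappa> e = (SOME e'. ratv e - ratv e' \<in> M)" for e :: "nat \<Rightarrow>\<^sub>0 nat"
  have self: "ratv e - ratv (\<kappa> e) \<in> M" for e
    unfolding \<kappa>_def by (rule someI[of _ e]) (simp add: vs.subspace_0[OF M])
  have \<kappa>: "\<kappa> e = \<kappa> e' \<longleftrightarrow> ratv e - ratv e' \<in> M" for e e'
  proof
    assume "\<kappa> e = \<kappa> e'"
    thus "ratv e - ratv e' \<in> M" using vs.subspace_diff[OF M self[of e] self[of e']] by simp
  next
    assume *: "ratv e - ratv e' \<in> M"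
    have "ratv e - ratv x \<in> M \<longleftrightarrow> ratv e' - ratv x \<in> M" for x
      using vs.subspace_diff[OF M, of "ratv e - ratv x" "ratv e - ratv e'"] *
        vs.subspace_add[OF M, of "ratv e' - ratv x" "ratv e - ratv e'"] by auto
    thus "\<kappa> e = \<kappa> e'" by (simp add: \<kappa>_def)
  qed
  have xb: "push \<kappa> (xbinom z :: 'k mpoly) = 0 \<longleftrightarrow> expdiff z \<in> M" for z
    by (cases z) (simp add: push_xbinom \<kappa> expdiff_def)
  have I: "ideal (push_ker \<kappa> V :: 'k mpoly set) (mpoly_ring V)"
    by (rule ideal_push_ker) (simp add: \<kappa> ratv_add)
  have DT: "xbinom ` D \<subseteq> (toric a V :: 'k mpoly set)" using D xbinom_rel_pairs by blast
  hence DV: "xbinom ` D \<subseteq> (polys V :: 'k mpoly set)" using toric_subset_polys by blast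
  have "xbinom ` D \<subseteq> (push_ker \<kappa> V :: 'k mpoly set)"
    using DV by (auto simp: push_ker_def xb M_def vs.span_base)
  hence sub: "toric a V \<subseteq> (push_ker \<kappa> V :: 'k mpoly set)"
    using genideal_mpoly(3)[OF DV I] gen by simp
  have "expdiff z \<in> M" if "z \<in> rel_pairs a V" for z
  proof -
    have "(xbinom z :: 'k mpoly) \<in> push_ker \<kappa> V" using that xbinom_rel_pairs sub by blast
    thus ?thesis by (simp add: push_ker_def xb)
  qed
  hence "vs.span (expdiff ` rel_pairs a V) \<subseteq> M" by (intro vs.span_minimal[OF _ M]) blast
  thus ?thesis using relspace_subset_span[of a V] unfolding M_def by blast
qed

lemma min_gens_toric_ge:
  assumes "\<forall>j\<in>V. a j \<noteq> 0"
  shows "enat (vs.dim (relspace a V)) \<le> min_gens (mpoly_ring V) (toric a V :: 'k::field mpoly set)"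
  unfolding min_gens_def
proof (rule INF_greatest)
  fix S :: "'k mpoly set"
  assume "S \<in> {S. finite S \<and> S \<subseteq> polys V \<and> genideal (mpoly_ring V) S = toric a V}"
  hence S: "finite S" "S \<subseteq> polys V" "genideal (mpoly_ring V) S = toric a V" by auto
  obtain D where D: "finite D" "D \<subseteq> rel_pairs a V" "card D \<le> card S"
    "genideal (mpoly_ring V) (xbinom ` D) = (toric a V :: 'k mpoly set)"
    by (rule binomial_generators[OF assms S])
  have "vs.dim (relspace a V) \<le> card (expdiff ` D)"
    using binomial_generators_span_relspace[OF D(2,4)] D(1) by (intro vs.dim_le_card) auto
  also have "\<dots> \<le> card S" using card_image_le[OF D(1)] D(3) by (rule order.trans)
  finally show "enat (vs.dim (relspace a V)) \<le> enat (card S)" by simp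
qed

lemma keys_add_nat: "keys (b + c) = keys b \<union> keys (c :: nat \<Rightarrow>\<^sub>0 nat)"
  by (auto simp: in_keys_iff lookup_add)

text \<open>
  By the face condition, setting the variables outside \<open>W\<close> to zero fixes the binomials in \<open>D\<close> that
  live on \<open>W\<close> and kills all others, so it maps the ideal they generate into the ideal generated
  by the former. It fixes \<open>toric a W\<close>.
\<close>

lemma generators_restrict:
  assumes "W \<subseteq> V" and face: "\<forall>(u, v)\<in>rel_pairs a V. keys u \<subseteq> W \<longrightarrow> keys v \<subseteq> W"
    and D: "D \<subseteq> rel_pairs a V" "genideal (mpoly_ring V) (xbinom ` D) = (toric a V :: 'k::field mpoly set)"
  shows "genideal (mpoly_ring W) (xbinom ` (D \<inter> rel_pairs a W)) = (toric a W :: 'k mpoly set)"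
proof
  let ?DW = "xbinom ` (D \<inter> rel_pairs a W) :: 'k mpoly set"
  let ?G = "genideal (mpoly_ring W) ?DW"
  have DT: "?DW \<subseteq> toric a W" using xbinom_rel_pairs by blast
  hence DWp: "?DW \<subseteq> polys W" using toric_subset_polys by blast
  note G = genideal_mpoly[OF DWp]
  show "?G \<subseteq> toric a W" by (rule G(3)[OF ideal_toric DT])
  define E where "E = {e :: nat \<Rightarrow>\<^sub>0 nat. keys e \<subseteq> W}"
  define I where "I = {p \<in> polys V. restr E p \<in> ?G}"
  have "ideal I (mpoly_ring V)"
  proof (rule ideal_mpolyI)
    fix p and e :: "nat \<Rightarrow>\<^sub>0 nat" and c :: 'k assume p: "p \<in> I" and e: "keys e \<subseteq> V"
    have "restr E (single e c * p) \<in> ?G"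
    proof (cases "keys e \<subseteq> W")
      case True
      hence "{e'. e + e' \<in> E} = E" by (auto simp: E_def keys_add_nat)
      thus ?thesis
        using p True by (auto simp: restr_single_mult I_def intro!: ideal_mpolyD(4)[OF G(1)] polys_single)
    next
      case False
      hence "{e'. e + e' \<in> E} = {}" by (auto simp: E_def keys_add_nat)
      thus ?thesis by (simp add: restr_single_mult ideal_mpolyD(2)[OF G(1)])
    qed
    thus "single e c * p \<in> I" using p e by (simp add: I_def polys_mult polys_single)
  qed (auto simp: I_def restr_add polys_add ideal_mpolyD(2,3)[OF G(1)])
  moreover have DV: "xbinom ` D \<subseteq> (polys V :: 'k mpoly set)"
    using D(1) xbinom_rel_pairs toric_subset_polys by blast
  moreover have "xbinom ` D \<subseteq> I"
  proof (rule image_subsetI)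
    fix z assume z: "z \<in> D"
    obtain u v where uv: "z = (u, v)" by (cases z)
    have "(u, v) \<in> rel_pairs a V" "(v, u) \<in> rel_pairs a V" using z D(1) by (auto simp: uv rel_pairs_def)
    hence iff: "u \<in> E \<longleftrightarrow> v \<in> E" using face by (auto simp: E_def)
    have "restr E (xbinom z :: 'k mpoly) \<in> ?G"
    proof (cases "u \<in> E")
      case True
      hence "z \<in> rel_pairs a W" using z D(1) iff by (auto simp: uv rel_pairs_def E_def)
      hence "xbinom z \<in> ?G" using G(2) z by blast
      thus ?thesis using True by (simp add: uv restr_xbinom[OF iff])
    next
      case False
      thus ?thesis by (simp add: uv restr_xbinom[OF iff] ideal_mpolyD(2)[OF G(1)])
    qed
    thus "xbinom z \<in> I" using z DV by (auto simp: I_def)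
  qed
  ultimately have sub: "toric a V \<subseteq> I" using genideal_mpoly(3)[OF DV] D(2) by simp
  show "toric a W \<subseteq> ?G"
  proof
    fix p :: "'k mpoly" assume p: "p \<in> toric a W"
    hence pW: "p \<in> polys W" using toric_subset_polys by blast
    hence "p \<in> toric a V" using p polys_mono[OF \<open>W \<subseteq> V\<close>] by (auto simp: toric_def push_ker_def)
    moreover have "restr E p = p"
      by (rule poly_mapping_eqI) (use pW in \<open>auto simp: lookup_restr E_def in_polys in_keys_iff\<close>)
    ultimately show "p \<in> ?G" using sub by (auto simp: I_def)
  qed
qed

section \<open>Restriction of complete intersections\<close>

lemma Inf_enat_mem:
  fixes A :: "enat set"
  assumes "A \<noteq> {}"
  shows "Inf A \<in> A"
proof -
  obtain x where "x \<in> A" using assms by blast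
  hence "(LEAST x. x \<in> A) \<in> A" by (rule LeastI)
  thus ?thesis using assms by (simp add: Inf_enat_def)
qed

text \<open>
  There are \<open>r\<close> binomial generators whose exponent differences span a space of dimension \<open>r\<close>, so these
  differences are distinct and independent. Those that live on \<open>W\<close> are independent in the relation
  space of \<open>W\<close>, which bounds the number of generators by the height.
\<close>

lemma complete_intersection_restrict:
  assumes V: "finite V" "W \<subseteq> V" and nz: "\<forall>j\<in>V. a j \<noteq> 0"
    and face: "\<forall>(u, v)\<in>rel_pairs a V. keys u \<subseteq> W \<longrightarrow> keys v \<subseteq> W"
    and ci: "complete_intersection (mpoly_ring V) (toric a V :: 'k::field mpoly set)"
  shows "complete_intersection (mpoly_ring W) (toric a W :: 'k mpoly set)"
proof -
  let ?r = "vs.dim (relspace a V)" and ?s = "vs.dim (relspace a W)"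
  have W: "finite W" using V finite_subset by blast
  let ?A = "{S :: 'k mpoly set. finite S \<and> S \<subseteq> polys V \<and> genideal (mpoly_ring V) S = toric a V}"
  have inf: "Inf ((\<lambda>S. enat (card S)) ` ?A) = enat ?r"
    using ci by (simp add: complete_intersection_def min_gens_def height_toric[OF V(1)])
  have "(\<lambda>S. enat (card S)) ` ?A \<noteq> {}"
  proof
    assume "(\<lambda>S. enat (card S)) ` ?A = {}"
    thus False using inf by (simp only: Inf_enat_def) simp
  qed
  hence "enat ?r \<in> (\<lambda>S. enat (card S)) ` ?A"
    unfolding inf[symmetric] by (rule Inf_enat_mem)
  then obtain S :: "'k mpoly set" where S: "finite S" "S \<subseteq> polys V" "genideal (mpoly_ring V) S = toric a V" "card S = ?r"
    by auto
  obtain D where D: "finite D" "D \<subseteq> rel_pairs a V" "card D \<le> card S"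
    "genideal (mpoly_ring V) (xbinom ` D) = (toric a V :: 'k mpoly set)"
    by (rule binomial_generators[OF nz S(1-3)])
  have span: "relspace a V \<subseteq> vs.span (expdiff ` D)"
    by (rule binomial_generators_span_relspace[OF D(2,4)])
  obtain B where B: "B \<subseteq> expdiff ` D" "vs.independent B" "expdiff ` D \<subseteq> vs.span B"
    using vs.maximal_independent_subset[of "expdiff ` D"] by metis
  have "relspace a V \<subseteq> vs.span B"
    using span vs.span_minimal[OF B(3)] by blast
  moreover have "finite B" using B(1) D(1) finite_surj by blast
  ultimately have "?r \<le> card B" by (intro vs.dim_le_card)
  moreover have "card B \<le> card (expdiff ` D)" using B(1) D(1) by (intro card_mono) auto
  moreover have "card (expdiff ` D) \<le> card D" using D(1) by (rule card_image_le)
  ultimately have eq: "card B = card (expdiff ` D)" "card (expdiff ` D) = card D"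
    using D(3) S(4) by linarith+
  have ind: "vs.independent (expdiff ` D)"
    using card_subset_eq[OF _ B(1) eq(1)] D(1) B(2) by simp
  have inj: "inj_on expdiff D" using eq_card_imp_inj_on[OF D(1) eq(2)] .
  let ?DW = "D \<inter> rel_pairs a W"
  have "vs.independent (expdiff ` ?DW)" by (rule vs.independent_mono[OF ind]) blast
  moreover have "expdiff ` ?DW \<subseteq> relspace a W" using expdiff_rel_pairs by blast
  ultimately have "card (expdiff ` ?DW) \<le> ?s"
    using card_le_dim[OF W subspace_relspace keys_relspace] by blast
  moreover have "card (expdiff ` ?DW) = card ?DW" by (intro card_image inj_on_subset[OF inj]) blast
  moreover have "card (xbinom ` ?DW :: 'k mpoly set) \<le> card ?DW" using D(1) by (intro card_image_le) auto
  ultimately have card: "card (xbinom ` ?DW :: 'k mpoly set) \<le> ?s" by linarith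
  have "(xbinom ` ?DW :: 'k mpoly set) \<subseteq> polys W"
    using xbinom_rel_pairs toric_subset_polys by blast
  hence "min_gens (mpoly_ring W) (toric a W :: 'k mpoly set) \<le> enat (card (xbinom ` ?DW :: 'k mpoly set))"
    unfolding min_gens_def
    using generators_restrict[OF V(2) face D(2,4)] D(1) by (intro INF_lower) simp
  also have "\<dots> \<le> enat ?s" using card by simp
  finally have "min_gens (mpoly_ring W) (toric a W :: 'k mpoly set) = enat ?s"
    using nz V(2) by (intro antisym min_gens_toric_ge) blast+
  thus ?thesis by (simp add: complete_intersection_def height_toric[OF W])
qed

section \<open>The toric ideal of a matrix\<close>

definition col_exponent :: "nat mat \<Rightarrow> nat \<Rightarrow> (nat \<Rightarrow>\<^sub>0 nat)" where
  "col_exponent A j = (\<Sum>i<dim_row A. single i (col A j $ i))"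

lemma mvar_power: "mvar i ^ k = xpow (single i k)"
  by (simp add: mvar_def xpow_power)

lemma monomial_of_col: "monomial_of (col A j) = xpow (col_exponent A j)"
  by (simp add: monomial_of_def col_exponent_def mvar_power prod_xpow)

lemma toric_hom_eq_push: "toric_hom A = push (lext (col_exponent A))"
  by (simp add: toric_hom_def monomial_of_col mpoly_subst_xpow)

lemma toric_ideal_eq_toric: "toric_ideal A = toric (col_exponent A) {..<dim_col A}"
  by (simp add: toric_ideal_def a_kernel_def' toric_hom_eq_push toric_def push_ker_def)

lemma lookup_col_exponent: "lookup (col_exponent A j) i = (if i < dim_row A then col A j $ i else 0)"
  by (simp add: col_exponent_def lookup_sum lookup_single when_def)

text \<open>
  Exponents are natural numbers, so nothing cancels. This is what makes the variables mapped into
  \<open>k[T]\<close> a face.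
\<close>

lemma keys_lext_subset_iff: "keys (lext a e) \<subseteq> T \<longleftrightarrow> (\<forall>j\<in>keys e. keys (a j) \<subseteq> T)"
  for a :: "nat \<Rightarrow> (nat \<Rightarrow>\<^sub>0 nat)"
  by (auto simp: in_keys_iff lookup_lext subset_iff)

lemma inv_vars_toric_hom:
  "inv_vars (toric_hom A :: 'k::field mpoly \<Rightarrow> _) n T = {j. j < n \<and> keys (col_exponent A j) \<subseteq> T}"
  by (simp add: inv_vars_def toric_hom_eq_push mvar_def push_simps in_polys
      pscale_1[where 'a = nat and 'b = nat, unfolded One_nat_def])

theorem proposition2p3:
  fixes A :: "nat mat" and m n :: nat and T :: "nat set"
    and \<phi> :: "'k::field mpoly \<Rightarrow> 'k mpoly" and P :: "'k mpoly set"
  assumes "A \<in> carrier_mat m n"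
    and "\<forall>j<n. col A j \<noteq> 0\<^sub>v m"
    and "\<phi> = toric_hom A"
    and "P = toric_ideal A"
    and "T \<subseteq> {..<m}"
    and "complete_intersection (mpoly_ring {..<n}) P"
  shows "complete_intersection (mpoly_ring (inv_vars \<phi> n T))
           (P \<inter> carrier (mpoly_ring (inv_vars \<phi> n T)))"
proof -
  define a where "a = col_exponent A"
  define W where "W = {j. j < n \<and> keys (a j) \<subseteq> T}"
  have dim: "dim_row A = m" "dim_col A = n" using assms(1) by auto
  have W: "inv_vars \<phi> n T = W" unfolding assms(3) W_def a_def by (rule inv_vars_toric_hom)
  have P: "P = toric a {..<n}" unfolding assms(4) a_def dim(2)[symmetric] by (rule toric_ideal_eq_toric)
  have WV: "W \<subseteq> {..<n}" by (auto simp: W_def)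
  have "P \<inter> polys W = toric a W"
    using polys_mono[OF WV] by (auto simp: P toric_def push_ker_def)
  moreover have "complete_intersection (mpoly_ring W) (toric a W :: 'k mpoly set)"
  proof (rule complete_intersection_restrict[OF finite_lessThan WV])
    show "complete_intersection (mpoly_ring {..<n}) (toric a {..<n} :: 'k mpoly set)"
      using assms(6) P by simp
    show "\<forall>j\<in>{..<n}. a j \<noteq> 0"
    proof
      fix j assume "j \<in> {..<n}"
      hence "col A j \<noteq> 0\<^sub>v m" using assms(2) by simp
      then obtain i where i: "i < m" "col A j $ i \<noteq> 0" using dim(1) by (auto simp: vec_eq_iff)
      show "a j \<noteq> 0"
      proof
        assume "a j = 0"
        hence "lookup (a j) i = 0" by simp
        thus False using i dim(1) by (simp add: a_def lookup_col_exponent)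
      qed
    qed
    have "keys v \<subseteq> W" if uv: "(u, v) \<in> rel_pairs a {..<n}" "keys u \<subseteq> W" for u v
    proof -
      have "keys (lext a u) \<subseteq> T" using uv(2) by (auto simp: keys_lext_subset_iff W_def)
      hence "keys (lext a v) \<subseteq> T" using uv(1) by (simp add: rel_pairs_def)
      thus ?thesis using uv(1) by (auto simp: keys_lext_subset_iff W_def rel_pairs_def)
    qed
    thus "\<forall>(u, v)\<in>rel_pairs a {..<n}. keys u \<subseteq> W \<longrightarrow> keys v \<subseteq> W" by blast
  qed
  ultimately show ?thesis by (simp add: W)
qed

end
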